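(* Let $G$ be a finitely generated abelian group. Then the following are equivalent: (i) $G$ has a connected Cayley graph that is not CCA; (ii) $G$ has a connected Cayley graph that is not strongly CCA; (iii) $G$ has a direct summand isomorphic to $\mathbb{Z}_4 \oplus \mathbb{Z}_2$ or to $\mathbb{Z}_{2^n} \oplus \mathbb{Z}_2 \oplus \mathbb{Z}_2$ for some $n \ge 3$.
   Context: Groups are abelian, written additively; $\mathbb{Z}_n$ is the cyclic group of order $n$. A Cayley graph of $G$ is a graph $\operatorname{Cay}(G;S)$, where $S$ is a subset of $G$ with $S = -S$ ($S$ is not required to be finite): it is the undirected graph whose vertices are the elements of $G$, with an edge joining $g$ and $g+s$ for all $g \in G$ and $s \in S$. (It is connected if and only if $S$ generates $G$.) An automorphism $\varphi$ of $\operatorname{Cay}(G;S)$ is colour-preserving if $\varphi(g+s) \in \{\varphi(g) \pm s\}$ for all $g \in G$ and $s \in S$. An automorphism $\varphi$ of $\operatorname{Cay}(G;S)$ is colour-permuting if there is a bijection $\pi \colon S \to S$ such that $\varphi(g+s) \in \{\varphi(g) \pm \pi(s)\}$ for all $g \in G$ and $s \in S$. A bijection $\varphi \colon G \to G$ is affine if there are a group automorphism $\tau$ of $G$ and an element $b \in G$ such that $\varphi(x) = \tau(x) + b$ for all $x \in G$. The graph $\operatorname{Cay}(G;S)$ is CCA if every colour-preserving automorphism of it is affine, and strongly CCA if every colour-permuting automorphism of it is affine. *)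

theory Defs
  imports
    "HOL-Algebra.Elementary_Groups"
    "HOL-Algebra.Generated_Groups"
    "Graph_Theory.Digraph_Component"
    "Graph_Theory.Pair_Digraph"
begin

text \<open>
  Abelian groups are multiplicative here, as in HOL-Algebra: the sum \<open>g + s\<close> is
  \<open>g \<otimes>\<^bsub>G\<^esub> s\<close>, and \<open>- s\<close> is \<open>inv\<^bsub>G\<^esub> s\<close>.
\<close>

definition finitely_generated_group :: "('a, 'm) monoid_scheme \<Rightarrow> bool" where
  "finitely_generated_group G \<longleftrightarrow>
     (\<exists>A. finite A \<and> A \<subseteq> carrier G \<and> generate G A = carrier G)"

definition inverse_closed_subset :: "('a, 'm) monoid_scheme \<Rightarrow> 'a set \<Rightarrow> bool" where
  "inverse_closed_subset G S \<longleftrightarrow> S \<subseteq> carrier G \<and> (\<lambda>s. inv\<^bsub>G\<^esub> s) ` S = S"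

text \<open>
  As usual in Graph-Theory, an undirected graph is a symmetric digraph. A neutral element
  in \<open>S\<close> is permitted; it gives a loop at every vertex.
\<close>

definition cayley_graph ::
  "('a, 'm) monoid_scheme \<Rightarrow> 'a set \<Rightarrow> ('a, 'a \<times> 'a) pre_digraph" where
  "cayley_graph G S = with_proj
     \<lparr> pverts = carrier G,
       parcs = {(g, g \<otimes>\<^bsub>G\<^esub> s) | g s. g \<in> carrier G \<and> s \<in> S} \<rparr>"

lemma sym_digraph_cayley_graph:
  assumes "group G" and "inverse_closed_subset G S"
  shows "sym_digraph (cayley_graph G S)"
proof -
  interpret group G by fact
  have S: "S \<subseteq> carrier G" and inv_S: "\<And>s. s \<in> S \<Longrightarrow> inv\<^bsub>G\<^esub> s \<in> S"
    using assms(2) by (auto simp: inverse_closed_subset_def)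
  have ends: "arcs_ends (cayley_graph G S) =
      {(g, g \<otimes>\<^bsub>G\<^esub> s) | g s. g \<in> carrier G \<and> s \<in> S}"
    by (simp add: cayley_graph_def arcs_ends_def arc_to_ends_def)
  show ?thesis
  proof
    fix e assume "e \<in> arcs (cayley_graph G S)"
    then show "tail (cayley_graph G S) e \<in> verts (cayley_graph G S)"
      and "head (cayley_graph G S) e \<in> verts (cayley_graph G S)"
      using S by (auto simp: cayley_graph_def)
  next
    show "symmetric (cayley_graph G S)"
      unfolding symmetric_def ends
    proof (rule symI)
      fix u v
      assume "(u, v) \<in> {(g, g \<otimes>\<^bsub>G\<^esub> s) | g s. g \<in> carrier G \<and> s \<in> S}"
      then obtain s where s: "u \<in> carrier G" "s \<in> S" "v = u \<otimes>\<^bsub>G\<^esub> s"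
        by blast
      have "u = v \<otimes>\<^bsub>G\<^esub> inv\<^bsub>G\<^esub> s" "v \<in> carrier G"
        using s S by (auto simp: m_assoc subset_iff)
      then show "(v, u) \<in> {(g, g \<otimes>\<^bsub>G\<^esub> s) | g s. g \<in> carrier G \<and> s \<in> S}"
        using inv_S[OF s(2)] by blast
    qed
  qed
qed

text \<open>
  The functions on the group below are total functions on the type \<open>'a\<close>; only their
  values on \<open>carrier G\<close> (for \<open>\<pi>\<close>, on \<open>S\<close>) matter.
\<close>

definition graph_automorphism :: "('a, 'b) pre_digraph \<Rightarrow> ('a \<Rightarrow> 'a) \<Rightarrow> bool" where
  "graph_automorphism \<Gamma> \<phi> \<longleftrightarrow>
     bij_betw \<phi> (verts \<Gamma>) (verts \<Gamma>) \<and>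
     (\<forall>u\<in>verts \<Gamma>. \<forall>v\<in>verts \<Gamma>. u \<rightarrow>\<^bsub>\<Gamma>\<^esub> v \<longleftrightarrow> \<phi> u \<rightarrow>\<^bsub>\<Gamma>\<^esub> \<phi> v)"

definition colour_preserving ::
  "('a, 'm) monoid_scheme \<Rightarrow> 'a set \<Rightarrow> ('a \<Rightarrow> 'a) \<Rightarrow> bool" where
  "colour_preserving G S \<phi> \<longleftrightarrow>
     (\<forall>g\<in>carrier G. \<forall>s\<in>S.
        \<phi> (g \<otimes>\<^bsub>G\<^esub> s) \<in> {\<phi> g \<otimes>\<^bsub>G\<^esub> s, \<phi> g \<otimes>\<^bsub>G\<^esub> inv\<^bsub>G\<^esub> s})"

definition colour_permuting ::
  "('a, 'm) monoid_scheme \<Rightarrow> 'a set \<Rightarrow> ('a \<Rightarrow> 'a) \<Rightarrow> bool" where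
  "colour_permuting G S \<phi> \<longleftrightarrow>
     (\<exists>\<pi>. bij_betw \<pi> S S \<and>
       (\<forall>g\<in>carrier G. \<forall>s\<in>S.
          \<phi> (g \<otimes>\<^bsub>G\<^esub> s) \<in> {\<phi> g \<otimes>\<^bsub>G\<^esub> \<pi> s, \<phi> g \<otimes>\<^bsub>G\<^esub> inv\<^bsub>G\<^esub> (\<pi> s)}))"

definition affine_map :: "('a, 'm) monoid_scheme \<Rightarrow> ('a \<Rightarrow> 'a) \<Rightarrow> bool" where
  "affine_map G \<phi> \<longleftrightarrow>
     (\<exists>\<tau>\<in>iso G G. \<exists>b\<in>carrier G. \<forall>x\<in>carrier G. \<phi> x = \<tau> x \<otimes>\<^bsub>G\<^esub> b)"

definition CCA :: "('a, 'm) monoid_scheme \<Rightarrow> 'a set \<Rightarrow> bool" where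
  "CCA G S \<longleftrightarrow>
     (\<forall>\<phi>. graph_automorphism (cayley_graph G S) \<phi> \<and> colour_preserving G S \<phi>
        \<longrightarrow> affine_map G \<phi>)"

definition strongly_CCA :: "('a, 'm) monoid_scheme \<Rightarrow> 'a set \<Rightarrow> bool" where
  "strongly_CCA G S \<longleftrightarrow>
     (\<forall>\<phi>. graph_automorphism (cayley_graph G S) \<phi> \<and> colour_permuting G S \<phi>
        \<longrightarrow> affine_map G \<phi>)"

text \<open>Internal direct sum; commutativity of \<open>G\<close> makes both summands normal.\<close>

definition direct_summand :: "'a set \<Rightarrow> ('a, 'm) monoid_scheme \<Rightarrow> bool" where
  "direct_summand H G \<longleftrightarrow> subgroup H G \<and>
     (\<exists>K. subgroup K G \<and> H \<inter> K = {\<one>\<^bsub>G\<^esub>} \<and> H <#>\<^bsub>G\<^esub> K = carrier G)"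

definition has_direct_summand_iso ::
  "('a, 'm) monoid_scheme \<Rightarrow> ('b, 'n) monoid_scheme \<Rightarrow> bool" where
  "has_direct_summand_iso G X \<longleftrightarrow>
     (\<exists>H. direct_summand H G \<and> G\<lparr>carrier := H\<rparr> \<cong> X)"

end

theory Submission
  imports Defs "HOL-Algebra.Multiplicative_Group" "HOL-Computational_Algebra.Primes"
begin

text \<open>
  All three conditions are equivalent to the existence of a critical pair: elements \<open>s\<close>, \<open>t\<close> of
  order 4 with \<open>2s = 2t\<close> such that none of \<open>s\<close>, \<open>t\<close>, \<open>s + t\<close> lies in \<open>2G\<close>.

  A colour-permuting \<open>\<phi>\<close> satisfies \<open>\<phi>(g + s) = \<phi>(g) \<plusminus> \<pi>(s)\<close>. If the sign never depends on \<open>g\<close>,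
  then \<open>\<phi>\<close> is affine. Comparing the two paths from \<open>g\<close> to \<open>g + s + t\<close> shows that the sign for \<open>s\<close>
  can change between \<open>g\<close> and \<open>g + t\<close> only if \<open>2s = 2t\<close> and \<open>4s = 0\<close>, and that the sign for \<open>t\<close> then
  changes between \<open>g\<close> and \<open>g + s\<close>; since the signs are \<open>2G\<close>-periodic, \<open>s\<close> and \<open>t\<close> form a critical
  pair. Conversely, a critical pair gives a subgroup \<open>N \<supseteq> 2G\<close> with \<open>G / N = \<langle>s, t\<rangle>\<close> of order 4, and
  translating the coset \<open>s + t + N\<close> by \<open>2s\<close> is a non-affine colour-preserving automorphism for the
  connection set \<open>N \<union> {\<plusminus>s, \<plusminus>t}\<close>.

  For the summands, let \<open>z = 2s = 2\<^sup>m w\<close> with \<open>m\<close> maximal, which exists because \<open>G\<close> is finitely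
  generated. If \<open>m = 1\<close>, then \<open>\<langle>s\<rangle> \<oplus> \<langle>s + t\<rangle>\<close> is a direct summand. Otherwise
  \<open>\<langle>w\<rangle> \<oplus> \<langle>s - 2\<^sup>m\<^sup>-\<^sup>1 w\<rangle> \<oplus> \<langle>s + t\<rangle>\<close> is one.
\<close>

section \<open>Subgroups and direct summands\<close>

text \<open>In additive notation this is the subgroup \<open>nG\<close>. It is applied to powers of
  2, where it measures divisibility by 2.\<close>

definition power_image :: "('a, 'm) monoid_scheme \<Rightarrow> nat \<Rightarrow> 'a set" where
  "power_image G n = (\<lambda>x. x [^]\<^bsub>G\<^esub> n) ` carrier G"

lemma (in monoid) power_image_2: "power_image G 2 = (\<lambda>x. x \<otimes> x) ` carrier G"
  unfolding power_image_def by (rule image_cong) (auto simp: numeral_2_eq_2)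

lemma (in monoid) power_image_subset: "power_image G n \<subseteq> carrier G"
  by (auto simp: power_image_def)

lemma (in monoid) power_image_antimono:
  assumes "m dvd n"
  shows "power_image G n \<subseteq> power_image G m"
proof
  fix x assume "x \<in> power_image G n"
  then obtain y where y: "y \<in> carrier G" "x = y [^] n"
    by (auto simp: power_image_def)
  obtain k where "n = m * k" using assms by blast
  then have "x = (y [^] k) [^] m"
    using y by (simp add: nat_pow_pow mult.commute)
  then show "x \<in> power_image G m"
    using y by (auto simp: power_image_def)
qed

lemma (in comm_group) subgroup_power_image: "subgroup (power_image G n) G"
proof
  show "power_image G n \<subseteq> carrier G" by (rule power_image_subset)
next
  fix x y assume "x \<in> power_image G n" "y \<in> power_image G n"
  then obtain a b where "a \<in> carrier G" "x = a [^] n" "b \<in> carrier G" "y = b [^] n"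
    by (auto simp: power_image_def)
  then have "x \<otimes> y = (a \<otimes> b) [^] n" "a \<otimes> b \<in> carrier G"
    by (auto simp: nat_pow_distrib)
  then show "x \<otimes> y \<in> power_image G n" by (auto simp: power_image_def)
next
  show "\<one> \<in> power_image G n"
    unfolding power_image_def by (rule image_eqI[of _ _ \<one>]) auto
next
  fix x assume "x \<in> power_image G n"
  then obtain a where "a \<in> carrier G" "x = a [^] n"
    by (auto simp: power_image_def)
  then have "inv x = (inv a) [^] n" "inv a \<in> carrier G"
    by (auto simp: nat_pow_inv)
  then show "inv x \<in> power_image G n" by (auto simp: power_image_def)
qed

lemma (in group) subgroup_mult_mem_cancel:
  assumes "subgroup H G" "x \<in> H" "y \<in> carrier G"
  shows "x \<otimes> y \<in> H \<longleftrightarrow> y \<in> H"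
proof
  assume "x \<otimes> y \<in> H"
  then have "inv x \<otimes> (x \<otimes> y) \<in> H"
    using assms by (meson subgroup.m_closed subgroup.m_inv_closed)
  then show "y \<in> H"
    using assms subgroup.mem_carrier[OF assms(1,2)] by (simp add: m_assoc[symmetric])
qed (use assms in \<open>auto intro: subgroup.m_closed\<close>)

lemma (in comm_group) subgroup_mult_mem_cancel':
  assumes "subgroup H G" "x \<in> H" "y \<in> carrier G"
  shows "y \<otimes> x \<in> H \<longleftrightarrow> y \<in> H"
  using subgroup_mult_mem_cancel[OF assms] m_comm assms subgroup.mem_carrier[OF assms(1,2)] by metis

lemma (in group) subset_set_mult_left:
  assumes "subgroup H G" "subgroup K G"
  shows "H \<subseteq> H <#> K"
  using subgroup.one_closed[OF assms(2)] subgroup.mem_carrier[OF assms(1)]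
  by (force simp: set_mult_def)

lemma (in group) subset_set_mult_right:
  assumes "subgroup H G" "subgroup K G"
  shows "K \<subseteq> H <#> K"
  using subgroup.one_closed[OF assms(1)] subgroup.mem_carrier[OF assms(2)]
  by (force simp: set_mult_def)

lemma (in group) mem_generate_singleton:
  assumes "a \<in> carrier G"
  shows "x \<in> generate G {a} \<longleftrightarrow> (\<exists>i::int. x = a [^] i)"
  using generate_pow[OF assms] by auto

lemma (in group) subgroup_generate_singleton:
  assumes "a \<in> carrier G"
  shows "subgroup (generate G {a}) G"
  using assms by (intro generate_is_subgroup) auto

lemma (in group) int_pow_double:
  assumes "a \<in> carrier G"
  shows "a [^] (2 * j :: int) = (a \<otimes> a) [^] j"
proof -
  have "a [^] (2 * j) = (a [^] (2::int)) [^] j"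
    using assms int_pow_pow by simp
  also have "a [^] (2::int) = a \<otimes> a"
    using int_pow_mult[OF assms, of 1 1] assms by simp
  finally show ?thesis .
qed

text \<open>Since \<open>a \<otimes> a\<close> lies in \<open>H\<close>, only the parity of the
  exponent of \<open>a\<close> matters, so \<open>H\<close> has index at most 2 in the enlarged
  subgroup. This serves both to show that adjoining \<open>a\<close> does not capture a given
  element and to exploit maximality among subgroups avoiding one.\<close>

lemma (in comm_group) adjoin_square_root:
  assumes H: "subgroup H G" and a: "a \<in> carrier G" "a \<otimes> a \<in> H"
    and x: "x \<in> H <#> generate G {a}"
  shows "x \<in> H \<or> x \<otimes> a \<in> H"
proof -
  obtain h and i :: int where h: "h \<in> H" and xe: "x = h \<otimes> a [^] i"
    using x a by (auto simp: set_mult_def mem_generate_singleton)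
  have hc: "h \<in> carrier G" using H h by (rule subgroup.mem_carrier)
  have ev: "a [^] (2 * j :: int) \<in> H" for j
    unfolding int_pow_double[OF a(1)] using H a(2) by (rule subgroup_int_pow_closed)
  show ?thesis
  proof (cases "even i")
    case True
    then have "a [^] i \<in> H" using ev by (metis evenE)
    then show ?thesis using xe h H by (auto intro: subgroup.m_closed)
  next
    case False
    then obtain j where "i + 1 = 2 * j" by (metis dvdE even_add odd_one)
    then have "a [^] (i + 1) \<in> H" using ev by simp
    moreover have "x \<otimes> a = h \<otimes> a [^] (i + 1)"
      unfolding xe using a hc by (simp add: int_pow_mult m_assoc)
    ultimately show ?thesis using h H by (auto intro: subgroup.m_closed)
  qed
qed

section \<open>Maximal subgroups and complements of cyclic 2-groups\<close>

text \<open>Zorn's lemma: any two elements of the union of a chain lie in a common member, so the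
  union is again a subgroup.\<close>

lemma (in group) maximal_subgroup_avoiding:
  assumes P: "subgroup P G" "z \<notin> P"
  obtains K where "subgroup K G" "P \<subseteq> K" "z \<notin> K"
    "\<And>X. \<lbrakk>subgroup X G; K \<subseteq> X; z \<notin> X\<rbrakk> \<Longrightarrow> X = K"
proof -
  let ?A = "{X. subgroup X G \<and> P \<subseteq> X \<and> z \<notin> X}"
  have "\<exists>M\<in>?A. \<forall>X\<in>?A. M \<subseteq> X \<longrightarrow> X = M"
  proof (rule subset_Zorn_nonempty)
    show "?A \<noteq> {}" using P by blast
  next
    fix C assume C: "C \<noteq> {}" "subset.chain ?A C"
    have mem: "\<And>X. X \<in> C \<Longrightarrow> X \<in> ?A" using C(2) by (auto simp: subset_chain_def)
    have lin: "\<And>X Y. X \<in> C \<Longrightarrow> Y \<in> C \<Longrightarrow> X \<subseteq> Y \<or> Y \<subseteq> X"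
      using C(2) by (auto simp: subset_chain_def)
    have "subgroup (\<Union>C) G"
    proof
      show "\<Union>C \<subseteq> carrier G" using mem by (auto dest: subgroup.subset)
      show "\<one> \<in> \<Union>C" using C(1) mem by (auto dest: subgroup.one_closed)
      show "inv x \<in> \<Union>C" if "x \<in> \<Union>C" for x
        using that mem by (auto dest: subgroup.m_inv_closed)
      show "x \<otimes> y \<in> \<Union>C" if xy: "x \<in> \<Union>C" "y \<in> \<Union>C" for x y
      proof -
        obtain X Y where "X \<in> C" "x \<in> X" "Y \<in> C" "y \<in> Y" using xy by blast
        then obtain Z where "Z \<in> C" "x \<in> Z" "y \<in> Z" using lin by blast
        then show ?thesis using mem by (auto dest: subgroup.m_closed)
      qed
    qed
    then show "\<Union>C \<in> ?A" using mem C(1) by blast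
  qed
  then obtain K where "K \<in> ?A" "\<forall>X\<in>?A. K \<subseteq> X \<longrightarrow> X = K" by blast
  then show ?thesis by (intro that[of K]) auto
qed

definition internal_sum :: "('a, 'm) monoid_scheme \<Rightarrow> 'a set \<Rightarrow> 'a set \<Rightarrow> bool" where
  "internal_sum G H K \<longleftrightarrow> subgroup H G \<and> subgroup K G \<and>
     H \<inter> K = {\<one>\<^bsub>G\<^esub>} \<and> H <#>\<^bsub>G\<^esub> K = carrier G"

lemma direct_summand_iff: "direct_summand H G \<longleftrightarrow> (\<exists>K. internal_sum G H K)"
  by (auto simp: direct_summand_def internal_sum_def)

text \<open>A subgroup maximal among those avoiding the socle \<open>w [^] 2 ^ m\<close> of \<open>\<langle>w\<rangle>\<close> is a complement of \<open>\<langle>w\<rangle>\<close>.\<close>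

lemma (in comm_group) cyclic_complement:
  fixes m :: nat
  assumes P: "subgroup P G" and w: "w \<in> carrier G" "w [^] (2 ^ Suc m :: nat) = \<one>"
    and pow: "power_image G (2 ^ Suc m) \<subseteq> P" and z: "w [^] (2 ^ m :: nat) \<notin> P"
  obtains K where "internal_sum G (generate G {w}) K" "P \<subseteq> K"
proof -
  define z' where "z' = w [^] (2 ^ m :: nat)"
  have zc: "z' \<in> carrier G" and zz: "z' \<otimes> z' = \<one>"
    using w by (auto simp: z'_def nat_pow_mult mult_2)
  obtain K where K: "subgroup K G" "P \<subseteq> K" "z' \<notin> K"
    and max: "\<And>X. \<lbrakk>subgroup X G; K \<subseteq> X; z' \<notin> X\<rbrakk> \<Longrightarrow> X = K"
    using maximal_subgroup_avoiding[OF P z] z'_def by metis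
  let ?W = "generate G {w}"
  have W: "subgroup ?W G" using w by (intro subgroup_generate_singleton)
  have Kc: "\<And>x. x \<in> K \<Longrightarrow> x \<in> carrier G" using K(1) by (rule subgroup.mem_carrier)
  have zW: "z' \<in> ?W"
    using w unfolding mem_generate_singleton[OF w(1)] z'_def by (metis int_pow_int)
  \<comment> \<open>By Bezout the power of \<open>w\<close> with exponent
    \<open>gcd i (2 ^ Suc m)\<close> is in \<open>K\<close> as well. This gcd is a power of 2; if it
    divided \<open>2 ^ m\<close>, then \<open>z'\<close> would be a power of that element and lie in
    \<open>K\<close>.\<close>
  have triv: "w [^] i = \<one>" if i: "w [^] i \<in> K" for i :: int
  proof -
    let ?g = "gcd i (2 ^ Suc m)"
    obtain u v where uv: "u * i + v * 2 ^ Suc m = ?g" using bezout_int by blast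
    have w2: "w [^] (2 ^ Suc m :: int) = \<one>"
      using w int_pow_int[of G w "2 ^ Suc m"] by simp
    have "w [^] ?g = (w [^] i) [^] u \<otimes> (w [^] (2 ^ Suc m :: int)) [^] v"
      unfolding uv[symmetric] using w(1)
      by (simp add: int_pow_mult int_pow_pow mult.commute)
    then have gK: "w [^] ?g \<in> K"
      using subgroup_int_pow_closed[OF K(1) i, of u] Kc by (simp only: w2) simp
    have "?g dvd 2 ^ Suc m" by simp
    then have "nat ?g dvd 2 ^ Suc m"
      by (metis gcd_ge_0_int int_dvd_int_iff int_nat_eq of_nat_numeral of_nat_power)
    then obtain a where a: "a \<le> Suc m" "nat ?g = 2 ^ a"
      by (meson divides_primepow_nat two_is_prime_nat)
    then have g: "?g = 2 ^ a"
      by (metis gcd_ge_0_int int_nat_eq of_nat_numeral of_nat_power)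
    have "a = Suc m"
    proof (rule ccontr)
      assume "a \<noteq> Suc m"
      then have "(2::int) ^ m = 2 ^ a * 2 ^ (m - a)"
        using a by (simp flip: power_add)
      then have "w [^] ((2::int) ^ m) = (w [^] ?g) [^] ((2::int) ^ (m - a))"
        using w g by (simp add: int_pow_pow)
      then have "w [^] ((2::int) ^ m) \<in> K"
        using subgroup_int_pow_closed[OF K(1) gK] by simp
      then show False using K(3) int_pow_int[of G w "2 ^ m"] by (simp add: z'_def)
    qed
    then have "2 ^ Suc m dvd i" using g by (metis gcd_dvd1)
    then obtain j where "i = 2 ^ Suc m * j" by blast
    then have "w [^] i = (w [^] (2 ^ Suc m :: int)) [^] j"
      using w(1) by (simp add: int_pow_pow)
    then show ?thesis by (simp only: w2) simp
  qed
  have WK: "subgroup (?W <#> K) G" using mult_subgroups[OF W K(1)] .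
  have Wsub: "?W \<subseteq> ?W <#> K" and Ksub: "K \<subseteq> ?W <#> K"
    using subset_set_mult_left[OF W K(1)] subset_set_mult_right[OF W K(1)] by auto
  \<comment> \<open>The quotient by \<open>?W <#> K\<close> has no element of order 2: correcting
    \<open>g\<close> by a power of \<open>w\<close> brings its square into \<open>K\<close>, and
    then maximality of \<open>K\<close> applies.\<close>
  have step: "g \<in> ?W <#> K" if g: "g \<in> carrier G" "g \<otimes> g \<in> ?W <#> K" for g
  proof -
    obtain i :: int and k where k: "k \<in> K" and gg: "g \<otimes> g = w [^] i \<otimes> k"
      using g(2) by (auto simp: set_mult_def mem_generate_singleton[OF w(1)])
    have "even i"
    proof (rule ccontr)
      assume "odd i"
      then obtain j where j: "i = 2 * j + 1" by (metis oddE)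
      \<comment> \<open>The power \<open>2 ^ m\<close> turns an odd power of \<open>w\<close> into
        \<open>z'\<close>, while \<open>pow\<close> puts the left side into
        \<open>K\<close>.\<close>
      have "g [^] (2 ^ Suc m :: nat) = (g \<otimes> g) [^] (2 ^ m :: nat)"
        using g(1) by (simp add: nat_pow_distrib nat_pow_mult mult_2)
      also have "\<dots> = (w [^] i) [^] (2 ^ m :: nat) \<otimes> k [^] (2 ^ m :: nat)"
        using gg w(1) k Kc by (simp add: nat_pow_distrib)
      also have "(w [^] i) [^] (2 ^ m :: nat) = z' [^] i"
        using w(1) unfolding z'_def by (metis int_pow_int int_pow_pow mult.commute)
      also have "z' [^] i = z'"
        using zc zz j by (simp add: int_pow_mult int_pow_double)
      finally have e: "g [^] (2 ^ Suc m :: nat) = z' \<otimes> k [^] (2 ^ m :: nat)" .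
      have "k [^] (2 ^ m :: nat) \<in> K"
        using subgroup_int_pow_closed[OF K(1) k, of "int (2 ^ m)"] by (simp only: int_pow_int)
      moreover have "g [^] (2 ^ Suc m :: nat) \<in> K"
        using pow K(2) g(1) by (auto simp: power_image_def)
      ultimately have "z' \<in> K"
        unfolding e using subgroup_mult_mem_cancel'[OF K(1) _ zc] by blast
      then show False using K(3) by blast
    qed
    then obtain j where j: "i = 2 * j" by blast
    define h where "h = g \<otimes> w [^] (- j)"
    have hc: "h \<in> carrier G" using g w by (simp add: h_def)
    have gh: "g = h \<otimes> w [^] j"
      using g w by (simp add: h_def m_assoc flip: int_pow_mult)
    have "h \<otimes> h = (g \<otimes> g) \<otimes> (w [^] (- j) \<otimes> w [^] (- j))"
      unfolding h_def using g w by (simp add: m_ac)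
    also have "\<dots> = k \<otimes> (w [^] i \<otimes> (w [^] (- j) \<otimes> w [^] (- j)))"
      unfolding gg using w k Kc by (simp add: m_ac)
    also have "w [^] i \<otimes> (w [^] (- j) \<otimes> w [^] (- j)) = \<one>"
      using w j by (simp flip: int_pow_mult)
    finally have hh: "h \<otimes> h \<in> K" using k Kc by simp
    have "h \<in> ?W <#> K"
    proof (cases "h \<in> K")
      case True
      then show ?thesis using Ksub by blast
    next
      case False
      let ?X = "K <#> generate G {h}"
      have H: "subgroup (generate G {h}) G" using hc by (rule subgroup_generate_singleton)
      have "h \<in> ?X" using subset_set_mult_right[OF K(1) H] by (auto intro: generate.incl)
      then have "?X \<noteq> K" using False by blast
      then have "z' \<in> ?X"
        using max[OF mult_subgroups[OF K(1) H]] subset_set_mult_left[OF K(1) H] by blast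
      \<comment> \<open>The alternative \<open>z' \<in> K\<close> is excluded. As \<open>z'\<close>
        is a power of \<open>w\<close>, this places \<open>h\<close> in
        \<open>?W <#> K\<close>.\<close>
      then have "z' \<otimes> h \<in> K"
        using adjoin_square_root[OF K(1) hc hh] K(3) by blast
      then show ?thesis
        using subgroup_mult_mem_cancel[OF WK _ hc, of z'] zW Wsub Ksub by blast
    qed
    moreover have "w [^] j \<in> ?W <#> K"
      using Wsub mem_generate_singleton[OF w(1)] by blast
    ultimately show ?thesis using gh subgroup.m_closed[OF WK] by simp
  qed
  \<comment> \<open>The exponent \<open>2 ^ Suc m\<close> sends all of \<open>G\<close> into
    \<open>K\<close>, so \<open>step\<close> can strip the squarings one at a time.\<close>
  have all: "g [^] (2 ^ j :: nat) \<in> ?W <#> K \<Longrightarrow> g \<in> ?W <#> K" if g: "g \<in> carrier G" for g j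
  proof (induction j)
    case 0
    then show ?case using g by (simp only: power_0 nat_pow_eone)
  next
    case (Suc j)
    have e: "g [^] (2 ^ Suc j :: nat) = g [^] (2 ^ j :: nat) \<otimes> g [^] (2 ^ j :: nat)"
      using g by (simp only: power_Suc mult_2 nat_pow_mult)
    show ?case
      by (rule Suc.IH, rule step) (use g Suc.prems e in \<open>simp_all only: nat_pow_closed\<close>)
  qed
  have "?W <#> K = carrier G"
  proof
    show "?W <#> K \<subseteq> carrier G" using WK by (rule subgroup.subset)
    show "carrier G \<subseteq> ?W <#> K"
    proof
      fix g assume g: "g \<in> carrier G"
      then have "g [^] (2 ^ Suc m :: nat) \<in> K" using pow K(2) by (auto simp: power_image_def)
      then show "g \<in> ?W <#> K" using all[OF g, of "Suc m"] Ksub by blast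
    qed
  qed
  moreover have "?W \<inter> K = {\<one>}"
  proof
    show "?W \<inter> K \<subseteq> {\<one>}"
    proof
      fix x assume x: "x \<in> ?W \<inter> K"
      then obtain i :: int where "x = w [^] i"
        unfolding Int_iff mem_generate_singleton[OF w(1)] by metis
      then show "x \<in> {\<one>}" using triv[of i] x by (metis IntD2 singletonI)
    qed
    show "{\<one>} \<subseteq> ?W \<inter> K"
      using subgroup.one_closed[OF K(1)] subgroup.one_closed[OF W] by blast
  qed
  ultimately have "internal_sum G ?W K" using W K(1) by (simp add: internal_sum_def)
  then show ?thesis using that K(2) by blast
qed

section \<open>Internal direct sums, direct products and cyclic groups\<close>

lemma mem_set_mult: "x \<in> H <#>\<^bsub>G\<^esub> K \<longleftrightarrow> (\<exists>h\<in>H. \<exists>k\<in>K. x = h \<otimes>\<^bsub>G\<^esub> k)"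
  by (auto simp: set_mult_def)

text \<open>Split \<open>g\<close> along \<open>H\<close> and \<open>M\<close>, then split its
  \<open>M\<close>-part along \<open>H'\<close> and \<open>M'\<close>. Since \<open>H'\<close> is
  inside \<open>M\<close>, the last factor stays in \<open>M\<close> and so lies in both
  complements.\<close>

lemma (in comm_group) internal_sum_refine:
  assumes HM: "internal_sum G H M" and HM': "internal_sum G H' M'"
    and sub: "H \<subseteq> M'" "H' \<subseteq> M"
  shows "internal_sum G (H <#> H') (M \<inter> M')"
proof -
  have s: "subgroup H G" "subgroup M G" "subgroup H' G" "subgroup M' G"
    using HM HM' by (auto simp: internal_sum_def)
  note c = subgroup.mem_carrier[OF s(1)] subgroup.mem_carrier[OF s(2)]
    subgroup.mem_carrier[OF s(3)] subgroup.mem_carrier[OF s(4)]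
  have S: "subgroup (H <#> H') G" "subgroup (M \<inter> M') G"
    using mult_subgroups[OF s(1,3)] subgroups_Inter_pair[OF s(2,4)] by auto
  have "x = \<one>" if x: "x \<in> H <#> H'" "x \<in> M" "x \<in> M'" for x
  proof -
    obtain h h' where h: "h \<in> H" "h' \<in> H'" "x = h \<otimes> h'"
      using x(1) by (auto simp: set_mult_def)
    have "h \<in> M" using x(2) h sub subgroup_mult_mem_cancel'[OF s(2), of h' h] c by blast
    then have "h = \<one>" using h HM by (auto simp: internal_sum_def)
    moreover have "h' \<in> M'" using x(3) h sub subgroup_mult_mem_cancel[OF s(4), of h h'] c by blast
    then have "h' = \<one>" using h HM' by (auto simp: internal_sum_def)
    ultimately show ?thesis using h by simp
  qed
  then have int: "(H <#> H') \<inter> (M \<inter> M') = {\<one>}"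
    using subgroup.one_closed[OF S(1)] subgroup.one_closed[OF S(2)] by blast
  have "g \<in> (H <#> H') <#> (M \<inter> M')" if g: "g \<in> carrier G" for g
  proof -
    have "g \<in> H <#> M" using g HM by (simp add: internal_sum_def)
    then obtain h m where h: "h \<in> H" "m \<in> M" "g = h \<otimes> m"
      by (auto simp: mem_set_mult)
    have "m \<in> H' <#> M'" using HM' h(2) c by (simp add: internal_sum_def)
    then obtain h' m' where h': "h' \<in> H'" "m' \<in> M'" "m = h' \<otimes> m'"
      by (auto simp: mem_set_mult)
    have "h' \<otimes> m' \<in> M" using h(2) h'(3) by simp
    then have "m' \<in> M" using h' sub subgroup_mult_mem_cancel[OF s(2), of h' m'] c by blast
    moreover have "g = (h \<otimes> h') \<otimes> m'" using h h' c by (simp add: m_assoc)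
    moreover have "h \<otimes> h' \<in> H <#> H'" using h h' by (auto simp: mem_set_mult)
    ultimately show ?thesis using h' unfolding mem_set_mult[of g] by blast
  qed
  moreover have "(H <#> H') <#> (M \<inter> M') \<subseteq> carrier G"
    using mult_subgroups[OF S] by (rule subgroup.subset)
  ultimately have "(H <#> H') <#> (M \<inter> M') = carrier G" by blast
  then show ?thesis using S int by (simp add: internal_sum_def)
qed

lemma (in comm_group) set_mult_iso_DirProd:
  assumes H: "subgroup H G" and K: "subgroup K G" and HK: "H \<inter> K = {\<one>}"
  shows "G\<lparr>carrier := H <#> K\<rparr> \<cong> G\<lparr>carrier := H\<rparr> \<times>\<times> G\<lparr>carrier := K\<rparr>"
proof -
  note c = subgroup.mem_carrier[OF H] subgroup.mem_carrier[OF K]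
  have "(\<lambda>(x, y). x \<otimes> y) \<in> iso (G\<lparr>carrier := H\<rparr> \<times>\<times> G\<lparr>carrier := K\<rparr>) (G\<lparr>carrier := H <#> K\<rparr>)"
  proof (rule isoI)
    show "(\<lambda>(x, y). x \<otimes> y) \<in> hom (G\<lparr>carrier := H\<rparr> \<times>\<times> G\<lparr>carrier := K\<rparr>) (G\<lparr>carrier := H <#> K\<rparr>)"
      by (rule homI) (auto simp: set_mult_def c m_ac)
    have "x = x' \<and> y = y'"
      if m: "x \<in> H" "y \<in> K" "x' \<in> H" "y' \<in> K" and e: "x \<otimes> y = x' \<otimes> y'" for x y x' y'
    proof -
      have "inv x' \<otimes> x = inv x' \<otimes> (x \<otimes> y) \<otimes> inv y"
        using m c by (simp add: m_assoc)
      also have "\<dots> = y' \<otimes> inv y"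
        unfolding e using m c by (simp add: m_assoc[symmetric])
      finally have d: "inv x' \<otimes> x = y' \<otimes> inv y" .
      have "inv x' \<otimes> x \<in> H" "y' \<otimes> inv y \<in> K"
        using m H K by (auto intro: subgroup.m_closed subgroup.m_inv_closed)
      then have "inv x' \<otimes> x = \<one>" "y' \<otimes> inv y = \<one>" using d HK by auto
      then show ?thesis using m c
        by (metis inv_closed inv_equality inv_inv)
    qed
    then have "inj_on (\<lambda>(x, y). x \<otimes> y) (H \<times> K)" by (auto simp: inj_on_def)
    then show "bij_betw (\<lambda>(x, y). x \<otimes> y) (carrier (G\<lparr>carrier := H\<rparr> \<times>\<times> G\<lparr>carrier := K\<rparr>))
      (carrier (G\<lparr>carrier := H <#> K\<rparr>))"
      by (auto simp: bij_betw_def set_mult_def)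
  qed
  moreover have "group (G\<lparr>carrier := H\<rparr> \<times>\<times> G\<lparr>carrier := K\<rparr>)"
    using H K by (intro DirProd_group subgroup_imp_group)
  ultimately show ?thesis using group.iso_sym is_isoI by blast
qed

lemma (in group) generate_singleton_iso:
  assumes w: "w \<in> carrier G"
  shows "G\<lparr>carrier := generate G {w}\<rparr> \<cong> integer_mod_group (ord w)"
proof -
  let ?Z = "integer_mod_group (ord w)"
  have mod: "w [^] (i mod int (ord w)) = w [^] i" for i :: int
    using w by (simp add: int_pow_eq mod_eq_dvd_iff[symmetric])
  have "(\<lambda>i::int. w [^] i) \<in> iso ?Z (G\<lparr>carrier := generate G {w}\<rparr>)"
  proof (rule isoI)
    show "(\<lambda>i::int. w [^] i) \<in> hom ?Z (G\<lparr>carrier := generate G {w}\<rparr>)"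
      using w by (intro homI) (auto simp: mem_generate_singleton mod int_pow_mult)
    have "i = j" if "i \<in> carrier ?Z" "j \<in> carrier ?Z" "w [^] i = w [^] j" for i j :: int
    \<comment> \<open>Order 0 stands for infinite order and \<open>integer_mod_group 0\<close> is
      the group of integers, so infinite cyclic groups are covered by the other case.\<close>
    proof (cases "ord w = 0")
      case False
      have "int (ord w) dvd j - i" using that(3) w by (simp add: int_pow_eq)
      then have "j mod int (ord w) = i mod int (ord w)" by (simp add: mod_eq_dvd_iff)
      then show ?thesis using that False by (simp add: carrier_integer_mod_group)
    qed (use that w in \<open>simp add: int_pow_eq\<close>)
    moreover have "\<exists>j\<in>carrier ?Z. w [^] i = w [^] j" for i :: int
      by (rule bexI[of _ "i mod int (ord w)"]) (auto simp: mod carrier_integer_mod_group)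
    ultimately show "bij_betw (\<lambda>i::int. w [^] i) (carrier ?Z) (carrier (G\<lparr>carrier := generate G {w}\<rparr>))"
      using w by (auto simp: bij_betw_def inj_on_def mem_generate_singleton image_iff)
  qed
  then show ?thesis using group.iso_sym[OF group_integer_mod_group] is_isoI by blast
qed

lemma (in group) ord_eq_prime_power:
  fixes p m :: nat
  assumes "prime p" "w \<in> carrier G" "w [^] (p ^ Suc m) = \<one>" "w [^] (p ^ m) \<noteq> \<one>"
  shows "ord w = p ^ Suc m"
proof -
  have "ord w dvd p ^ Suc m" "\<not> ord w dvd p ^ m" using assms by (auto simp: pow_eq_id)
  then show ?thesis
    using assms(1) by (metis divides_primepow_nat le_Suc_eq le_imp_power_dvd)
qed

section \<open>Involutions in finitely generated abelian groups\<close>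

text \<open>Expanding the square shows that \<open>a [^] (2 * i)\<close> is inverse to
  \<open>k \<otimes> k\<close>. The absolute value gives a natural exponent, so for
  \<open>i \<noteq> 0\<close> the element \<open>a\<close> has finite order modulo
  \<open>K\<close>.\<close>

lemma (in comm_group) involution_coset_power_mem:
  fixes i :: int
  assumes K: "subgroup K G" "k \<in> K" and a: "a \<in> carrier G"
    and e: "(k \<otimes> a [^] i) \<otimes> (k \<otimes> a [^] i) = \<one>"
  shows "a [^] (nat \<bar>2 * i\<bar>) \<in> K"
proof -
  have kc: "k \<in> carrier G" using K by (rule subgroup.mem_carrier)
  define y where "y = a [^] i"
  have y: "y \<in> carrier G" using a by (simp add: y_def)
  have "(k \<otimes> k) \<otimes> (y \<otimes> y) = (k \<otimes> y) \<otimes> (k \<otimes> y)"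
    using kc y by (simp add: m_ac)
  then have "(k \<otimes> k) \<otimes> (y \<otimes> y) \<in> K"
    using e subgroup.one_closed[OF K(1)] by (simp add: y_def)
  then have "y \<otimes> y \<in> K"
    using subgroup_mult_mem_cancel[OF K(1), of "k \<otimes> k" "y \<otimes> y"] K y
    by (simp add: subgroup.m_closed)
  then have p: "a [^] (2 * i) \<in> K"
    using a by (simp only: mult_2 int_pow_mult y_def)
  then have "a [^] (- (2 * i)) \<in> K"
    using a K by (simp add: int_pow_neg subgroup.m_inv_closed)
  with p have "a [^] \<bar>2 * i\<bar> \<in> K" by (cases "2 * i < 0") (simp_all only: abs_if if_True if_False)
  moreover have "\<bar>2 * i\<bar> = int (nat \<bar>2 * i\<bar>)" by simp
  ultimately show ?thesis by (metis int_pow_int)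
qed

text \<open>Induction on the generators. A new generator \<open>a\<close> either has finite order
  modulo the old subgroup, which leaves finitely many cosets with finitely many solutions each, or
  it has infinite order, and then every solution already lies in the old subgroup.\<close>

lemma (in comm_group) finite_involutions:
  assumes fg: "finitely_generated_group G"
  shows "finite {x \<in> carrier G. x \<otimes> x = \<one>}"
proof -
  obtain A where A: "finite A" "A \<subseteq> carrier G" "generate G A = carrier G"
    using fg by (auto simp: finitely_generated_group_def)
  have "finite B \<Longrightarrow> B \<subseteq> carrier G \<Longrightarrow> finite {x \<in> generate G B. x \<otimes> x = \<one>}" for B
  proof (induction B rule: finite_induct)
    case empty
    then show ?case by (simp add: generate_empty)
  next
    case (insert a B)
    let ?B = "generate G B"
    have a: "a \<in> carrier G" and Bc: "B \<subseteq> carrier G" using insert by auto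
    have B: "subgroup ?B G" using Bc by (rule generate_is_subgroup)
    note c = subgroup.mem_carrier[OF B]
    have fin: "finite {x \<in> ?B. x \<otimes> x = \<one>}" using insert by auto
    \<comment> \<open>Two solutions in the same coset differ by a solution in \<open>?B\<close>, so
      a nonempty \<open>?C\<close> is contained in a translate of the finite set
      \<open>fin\<close>.\<close>
    have fin_coset: "finite {b \<otimes> y |b. b \<in> ?B \<and> (b \<otimes> y) \<otimes> (b \<otimes> y) = \<one>}" (is "finite ?C")
      if y: "y \<in> carrier G" for y
    proof (cases "?C = {}")
      case False
      then obtain b where b: "b \<in> ?B" "(b \<otimes> y) \<otimes> (b \<otimes> y) = \<one>" by blast
      have "?C \<subseteq> (\<lambda>x. x \<otimes> (b \<otimes> y)) ` {x \<in> ?B. x \<otimes> x = \<one>}"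
      proof
        fix x assume "x \<in> ?C"
        then obtain b' where b': "x = b' \<otimes> y" "b' \<in> ?B" "(b' \<otimes> y) \<otimes> (b' \<otimes> y) = \<one>" by blast
        have m: "b' \<otimes> inv b \<in> ?B"
          using b b' B by (auto intro: subgroup.m_closed subgroup.m_inv_closed)
        have x: "x = (b' \<otimes> inv b) \<otimes> (b \<otimes> y)"
          unfolding b'(1) using b(1) b'(2) c y by (metis inv_closed l_inv l_one m_assoc m_closed)
        have "(b' \<otimes> inv b) \<otimes> (b' \<otimes> inv b) \<otimes> ((b \<otimes> y) \<otimes> (b \<otimes> y)) = x \<otimes> x"
          unfolding x using b(1) b'(2) c y by (simp add: m_ac)
        then have "(b' \<otimes> inv b) \<otimes> (b' \<otimes> inv b) = \<one>"
          unfolding b(2) using b' b c y by simp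
        then show "x \<in> (\<lambda>x. x \<otimes> (b \<otimes> y)) ` {x \<in> ?B. x \<otimes> x = \<one>}" using m x by blast
      qed
      then show ?thesis using fin finite_subset by blast
    qed (simp only: finite.emptyI)
    have gi: "\<exists>b\<in>?B. \<exists>i::int. x = b \<otimes> a [^] i" if "x \<in> generate G (insert a B)" for x
    proof -
      have W: "subgroup (generate G {a}) G" using a by (rule subgroup_generate_singleton)
      have "insert a B \<subseteq> ?B <#> generate G {a}"
        using subset_set_mult_left[OF B W] subset_set_mult_right[OF B W]
        by (auto intro: generate.incl)
      then have "x \<in> ?B <#> generate G {a}"
        using generate_subgroup_incl[OF _ mult_subgroups[OF B W]] that by blast
      then obtain b y where b: "b \<in> ?B" "y \<in> generate G {a}" "x = b \<otimes> y"
        by (auto simp: set_mult_def)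
      then obtain i :: int where "y = a [^] i" using mem_generate_singleton[OF a] by metis
      then show ?thesis using b by blast
    qed
    show ?case
    proof (cases "\<exists>k::nat. k > 0 \<and> a [^] k \<in> ?B")
      case True
      then obtain k :: nat where k: "k > 0" "a [^] k \<in> ?B" by blast
      have "{x \<in> generate G (insert a B). x \<otimes> x = \<one>} \<subseteq>
        (\<Union>j\<in>{0..<int k}. {b \<otimes> a [^] j |b. b \<in> ?B \<and> (b \<otimes> a [^] j) \<otimes> (b \<otimes> a [^] j) = \<one>})"
      proof
        fix x assume x: "x \<in> {x \<in> generate G (insert a B). x \<otimes> x = \<one>}"
        then obtain b i where b: "b \<in> ?B" "x = b \<otimes> a [^] (i::int)" using gi by blast
        have "a [^] i = a [^] (int k * (i div int k) + i mod int k)" by simp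
        also have "\<dots> = (a [^] k) [^] (i div int k) \<otimes> a [^] (i mod int k)"
          using a by (metis int_pow_closed int_pow_int int_pow_mult int_pow_pow)
        finally have "x = (b \<otimes> (a [^] k) [^] (i div int k)) \<otimes> a [^] (i mod int k)"
          using b a c by (simp add: m_assoc)
        moreover have "b \<otimes> (a [^] k) [^] (i div int k) \<in> ?B"
          using b k B subgroup_int_pow_closed by (auto intro: subgroup.m_closed)
        moreover have "i mod int k \<in> {0..<int k}" using k by simp
        ultimately show "x \<in> (\<Union>j\<in>{0..<int k}. {b \<otimes> a [^] j |b. b \<in> ?B \<and> (b \<otimes> a [^] j) \<otimes> (b \<otimes> a [^] j) = \<one>})"
          using x by blast
      qed
      moreover have "finite (\<Union>j\<in>{0..<int k}. {b \<otimes> a [^] j |b. b \<in> ?B \<and> (b \<otimes> a [^] j) \<otimes> (b \<otimes> a [^] j) = \<one>})"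
        using fin_coset a by auto
      ultimately show ?thesis by (rule finite_subset)
    next
      case False
      have "{x \<in> generate G (insert a B). x \<otimes> x = \<one>} \<subseteq> {x \<in> ?B. x \<otimes> x = \<one>}"
      proof
        fix x assume x: "x \<in> {x \<in> generate G (insert a B). x \<otimes> x = \<one>}"
        then obtain b i where b: "b \<in> ?B" "x = b \<otimes> a [^] (i::int)" using gi by blast
        have "a [^] (nat \<bar>2 * i\<bar>) \<in> ?B"
          by (rule involution_coset_power_mem[OF B b(1) a]) (use x b in simp)
        with False have "\<not> nat \<bar>2 * i\<bar> > 0" by metis
        then have "i = 0" by simp
        then show "x \<in> {x \<in> ?B. x \<otimes> x = \<one>}" using x b c by simp
      qed
      then show ?thesis using fin finite_subset by blast
    qed
  qed
  then show ?thesis using A by metis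
qed

text \<open>If \<open>K\<close> is maximal among the subgroups avoiding the involution \<open>z\<close>, then every generator of
  \<open>G\<close> has finite order modulo \<open>K\<close>, so \<open>G / K\<close> has finite exponent.\<close>

lemma (in comm_group) involution_finite_height:
  assumes fg: "finitely_generated_group G"
    and z: "z \<in> carrier G" "z \<otimes> z = \<one>" "z \<noteq> \<one>"
  obtains a where "z \<notin> power_image G (2 ^ a)"
proof -
  obtain A where A: "finite A" "A \<subseteq> carrier G" "generate G A = carrier G"
    using fg by (auto simp: finitely_generated_group_def)
  have "subgroup {\<one>} G" by (rule triv_subgroup)
  then obtain K where K: "subgroup K G" "z \<notin> K"
    and max: "\<And>X. \<lbrakk>subgroup X G; K \<subseteq> X; z \<notin> X\<rbrakk> \<Longrightarrow> X = K"
    using maximal_subgroup_avoiding[of "{\<one>}" z] z(3) by (metis singletonD)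
  note c = subgroup.mem_carrier[OF K(1)]
  have "\<exists>k::nat. k > 0 \<and> a [^] k \<in> K" if a: "a \<in> A" for a
  proof (cases "a \<in> K")
    case True
    then show ?thesis using c by (intro exI[of _ 1]) simp
  next
    case False
    have ac: "a \<in> carrier G" using a A by blast
    have W: "subgroup (generate G {a}) G" using ac by (rule subgroup_generate_singleton)
    have "a \<in> K <#> generate G {a}"
      using subset_set_mult_right[OF K(1) W] by (auto intro: generate.incl)
    \<comment> \<open>By maximality, enlarging \<open>K\<close> by \<open>a\<close> captures
      \<open>z\<close>. In \<open>z = k \<otimes> a [^] i\<close> the exponent is nonzero because
      \<open>z \<notin> K\<close>, so \<open>a\<close> has finite order modulo
      \<open>K\<close>.\<close>
    then have "z \<in> K <#> generate G {a}"
      using False max[OF mult_subgroups[OF K(1) W]] subset_set_mult_left[OF K(1) W] by blast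
    then obtain k y where k: "k \<in> K" and y: "y \<in> generate G {a}" "z = k \<otimes> y"
      by (auto simp: set_mult_def)
    obtain i :: int where i: "y = a [^] i" using y(1) mem_generate_singleton[OF ac] by metis
    have "a [^] (nat \<bar>2 * i\<bar>) \<in> K"
      by (rule involution_coset_power_mem[OF K(1) k ac]) (use z(2) y i in simp)
    moreover have "i \<noteq> 0" using k y i K(2) c by (metis int_pow_0 r_one)
    ultimately show ?thesis by (intro exI[of _ "nat \<bar>2 * i\<bar>"]) auto
  qed
  then obtain k :: "'a \<Rightarrow> nat" where k: "\<And>a. a \<in> A \<Longrightarrow> k a > 0 \<and> a [^] k a \<in> K" by metis
  \<comment> \<open>A common exponent of the generators modulo \<open>K\<close>, hence an exponent
    of \<open>G / K\<close>. Only its power of 2 matters, since odd powers leave the involution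
    \<open>z\<close> unchanged.\<close>
  define M where "M = prod k A"
  have M: "M > 0" using k A(1) by (simp add: M_def prod_pos)
  have "a [^] M \<in> K" if a: "a \<in> A" for a
  proof -
    obtain d where d: "M = k a * d" using a A(1) unfolding M_def by (meson dvd_prodI dvdE)
    have ac: "a \<in> carrier G" using a A(2) by blast
    have "a [^] M = (a [^] k a) [^] int d"
      unfolding d int_pow_int by (rule nat_pow_pow[OF ac, symmetric])
    also have "\<dots> \<in> K" using k[OF a] by (intro subgroup_int_pow_closed K) simp
    finally show ?thesis .
  qed
  then have "A \<subseteq> {x \<in> carrier G. x [^] M \<in> K}" using A by blast
  moreover have "subgroup {x \<in> carrier G. x [^] M \<in> K} G"
    by standard (use K in \<open>auto simp: nat_pow_distrib nat_pow_inv
      intro: subgroup.m_closed subgroup.m_inv_closed subgroup.one_closed\<close>)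
  ultimately have all: "\<And>x. x \<in> carrier G \<Longrightarrow> x [^] M \<in> K"
    using generate_subgroup_incl A(3) by blast
  obtain a b where ab: "M = 2 ^ a * b" "odd b"
  proof (rule multiplicity_decompose'[of M "2::nat"])
    show "M \<noteq> 0" using M by simp
  qed (use that in auto)
  have "z \<notin> power_image G (2 ^ a)"
  proof
    assume "z \<in> power_image G (2 ^ a)"
    then obtain x where x: "x \<in> carrier G" "z = x [^] (2 ^ a :: nat)"
      by (auto simp: power_image_def)
    have "z [^] b = x [^] M" using x ab by (simp add: nat_pow_pow)
    moreover have "z [^] b = z"
    proof -
      obtain j where j: "b = 2 * j + 1" using ab(2) by (metis oddE)
      have "z [^] int b = z [^] (2 * int j) \<otimes> z"
        unfolding j using z(1) by (simp add: int_pow_mult m_comm)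
      also have "\<dots> = z" using z(1) unfolding int_pow_double[OF z(1)] z(2) by simp
      finally have "z [^] int b = z" .
      then show ?thesis by (simp only: int_pow_int)
    qed
    ultimately show False using all[OF x(1)] K(2) by simp
  qed
  then show ?thesis using that by blast
qed

section \<open>Critical pairs and Cayley graphs\<close>

text \<open>The last three conditions say that the images of \<open>s\<close> and \<open>t\<close>
  in \<open>G / 2G\<close> are linearly independent over the field with two elements.\<close>

definition critical_pair :: "('a, 'm) monoid_scheme \<Rightarrow> 'a \<Rightarrow> 'a \<Rightarrow> bool" where
  "critical_pair G s t \<longleftrightarrow> s \<in> carrier G \<and> t \<in> carrier G \<and>
     s \<otimes>\<^bsub>G\<^esub> s = t \<otimes>\<^bsub>G\<^esub> t \<and> s \<otimes>\<^bsub>G\<^esub> s \<noteq> \<one>\<^bsub>G\<^esub> \<and>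
     (s \<otimes>\<^bsub>G\<^esub> s) \<otimes>\<^bsub>G\<^esub> (s \<otimes>\<^bsub>G\<^esub> s) = \<one>\<^bsub>G\<^esub> \<and>
     s \<notin> power_image G 2 \<and> t \<notin> power_image G 2 \<and> s \<otimes>\<^bsub>G\<^esub> t \<notin> power_image G 2"

lemma (in group) affine_map_mult:
  assumes "affine_map G \<phi>" "x \<in> carrier G" "y \<in> carrier G" "\<phi> \<one> = \<one>"
  shows "\<phi> (x \<otimes> y) = \<phi> x \<otimes> \<phi> y"
proof -
  obtain \<tau> b where \<tau>: "\<tau> \<in> iso G G" and b: "b \<in> carrier G"
    and \<phi>: "\<And>x. x \<in> carrier G \<Longrightarrow> \<phi> x = \<tau> x \<otimes> b"
    using assms(1) by (auto simp: affine_map_def)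
  have h: "\<tau> \<in> hom G G" using \<tau> by (simp add: iso_def)
  have "b = \<one>" using \<phi>[OF one_closed] assms(4) b hom_one[OF h is_group is_group] by simp
  moreover have "\<tau> x \<in> carrier G" if "x \<in> carrier G" for x using h that by (rule hom_in_carrier)
  ultimately show ?thesis using assms(2,3) \<phi> hom_mult[OF h] by simp
qed

lemma (in group) connected_cayley_graph_iff:
  assumes S: "inverse_closed_subset G S"
  shows "connected (cayley_graph G S) \<longleftrightarrow> generate G S = carrier G"
proof -
  have Sc: "S \<subseteq> carrier G" and inv_S: "\<And>s. s \<in> S \<Longrightarrow> inv s \<in> S"
    using S by (auto simp: inverse_closed_subset_def)
  interpret D: sym_digraph "cayley_graph G S"
    using is_group S by (rule sym_digraph_cayley_graph)
  have verts: "verts (cayley_graph G S) = carrier G" by (simp add: cayley_graph_def)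
  have ends: "arcs_ends (cayley_graph G S) = {(g, g \<otimes> s) | g s. g \<in> carrier G \<and> s \<in> S}"
    by (simp add: cayley_graph_def arcs_ends_def arc_to_ends_def)
  \<comment> \<open>\<open>connected\<close> refers to the symmetric closure. The Cayley graph is
    symmetric already, so this is plain directed reachability.\<close>
  have reach_iff: "connected (cayley_graph G S) \<longleftrightarrow>
      (\<forall>u\<in>carrier G. \<forall>v\<in>carrier G. u \<rightarrow>\<^sup>*\<^bsub>cayley_graph G S\<^esub> v)"
    using D.sym_arcs unfolding connected_def strongly_connected_def
    by (simp add: D.reachable_mk_symmetric_eq verts carrier_not_empty)
  show ?thesis
  proof
    assume "connected (cayley_graph G S)"
    then have r: "\<one> \<rightarrow>\<^sup>*\<^bsub>cayley_graph G S\<^esub> v" if "v \<in> carrier G" for v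
      using reach_iff that by blast
    have "v \<in> generate G S" if v: "\<one> \<rightarrow>\<^sup>*\<^bsub>cayley_graph G S\<^esub> v" for v
      using v
    proof (induction rule: D.reachable_induct)
      case base
      show ?case by (rule generate.one)
    next
      case (step x y)
      then obtain s where "s \<in> S" "y = x \<otimes> s" by (auto simp: ends)
      then show ?case using step.IH by (auto intro: generate.eng generate.incl)
    qed
    then show "generate G S = carrier G" using r generate_incl[OF Sc] by blast
  next
    assume gen: "generate G S = carrier G"
    have "u \<rightarrow>\<^sup>*\<^bsub>cayley_graph G S\<^esub> (u \<otimes> h)" if h: "h \<in> generate G S" and u: "u \<in> carrier G" for u h
      using h u
    \<comment> \<open>The start vertex varies because the path for a second factor begins where the
      path for the first one ends.\<close>
    proof (induction h arbitrary: u rule: generate.induct)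
      case one
      then show ?case by (simp add: verts)
    next
      case (incl h)
      then show ?case by (intro D.reachable_adjI) (auto simp: ends)
    next
      case (inv h)
      then show ?case using inv_S by (intro D.reachable_adjI) (auto simp: ends)
    next
      case (eng h1 h2)
      have c: "h1 \<in> carrier G" "h2 \<in> carrier G" using eng gen by auto
      have "u \<rightarrow>\<^sup>*\<^bsub>cayley_graph G S\<^esub> (u \<otimes> h1)" using eng by blast
      also have "(u \<otimes> h1) \<rightarrow>\<^sup>*\<^bsub>cayley_graph G S\<^esub> (u \<otimes> h1 \<otimes> h2)" using eng c by blast
      finally show ?case using c eng.prems by (simp add: m_assoc)
    qed
    note R = this
    have "u \<rightarrow>\<^sup>*\<^bsub>cayley_graph G S\<^esub> v" if uv: "u \<in> carrier G" "v \<in> carrier G" for u v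
    proof -
      have "u \<rightarrow>\<^sup>*\<^bsub>cayley_graph G S\<^esub> (u \<otimes> (inv u \<otimes> v))" using uv gen by (intro R) auto
      then show ?thesis using uv by (simp add: m_assoc[symmetric])
    qed
    then show "connected (cayley_graph G S)" using reach_iff by blast
  qed
qed

lemma (in group) cayley_graph_adj_iff:
  assumes "S \<subseteq> carrier G" "u \<in> carrier G" "v \<in> carrier G"
  shows "u \<rightarrow>\<^bsub>cayley_graph G S\<^esub> v \<longleftrightarrow> inv u \<otimes> v \<in> S"
proof
  assume "u \<rightarrow>\<^bsub>cayley_graph G S\<^esub> v"
  then obtain s where "s \<in> S" "v = u \<otimes> s"
    by (auto simp: cayley_graph_def arcs_ends_def arc_to_ends_def)
  then show "inv u \<otimes> v \<in> S" using assms by (auto simp: m_assoc[symmetric])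
next
  assume "inv u \<otimes> v \<in> S"
  moreover have "v = u \<otimes> (inv u \<otimes> v)" using assms by (simp add: m_assoc[symmetric])
  ultimately show "u \<rightarrow>\<^bsub>cayley_graph G S\<^esub> v"
    using assms by (auto simp: cayley_graph_def arcs_ends_def arc_to_ends_def)
qed

text \<open>The automorphism translates the coset \<open>s \<otimes> t \<otimes> N\<close> of a subgroup \<open>N\<close> of index 4 by the
  involution \<open>s \<otimes> s\<close> and fixes everything else.\<close>

lemma (in comm_group) critical_pair_imp_not_CCA:
  assumes "critical_pair G s t"
  obtains S where "inverse_closed_subset G S" "connected (cayley_graph G S)" "\<not> CCA G S"
proof -
  have s: "s \<in> carrier G" and t: "t \<in> carrier G" and st: "s \<otimes> s = t \<otimes> t"
    and z1: "s \<otimes> s \<noteq> \<one>" and zz: "(s \<otimes> s) \<otimes> (s \<otimes> s) = \<one>"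
    and nsq: "s \<notin> power_image G 2" "t \<notin> power_image G 2" "s \<otimes> t \<notin> power_image G 2"
    using assms by (auto simp: critical_pair_def)
  define z where "z = s \<otimes> s"
  have zc: "z \<in> carrier G" using s by (simp add: z_def)
  let ?P = "power_image G 2"
  have P: "subgroup ?P G" by (rule subgroup_power_image)
  have sq: "x \<otimes> x \<in> ?P" if "x \<in> carrier G" for x using that by (auto simp: power_image_2)
  \<comment> \<open>\<open>M\<close> has index 2: it is maximal among the subgroups that contain all
    squares and \<open>b\<close> and avoid \<open>a\<close>, and the last conjunct says that its
    only other coset is that of \<open>a\<close>.\<close>
  have complement: "\<exists>M. subgroup M G \<and> ?P \<subseteq> M \<and> b \<in> M \<and> a \<notin> M \<and>
      (\<forall>g\<in>carrier G. g \<in> M \<or> inv a \<otimes> g \<in> M)"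
    if a: "a \<in> carrier G" "a \<notin> ?P" and b: "b \<in> carrier G" "a \<otimes> b \<notin> ?P" for a b
  proof -
    have B: "subgroup (generate G {b}) G" using b by (intro subgroup_generate_singleton)
    have PB: "subgroup (?P <#> generate G {b}) G" using mult_subgroups[OF P B] .
    have sub: "?P \<subseteq> ?P <#> generate G {b}" using subset_set_mult_left[OF P B] .
    have "a \<notin> ?P <#> generate G {b}" using adjoin_square_root[OF P b(1) sq[OF b(1)]] a b by blast
    then obtain M where M: "subgroup M G" "?P <#> generate G {b} \<subseteq> M" "a \<notin> M"
      and max: "\<And>X. \<lbrakk>subgroup X G; M \<subseteq> X; a \<notin> X\<rbrakk> \<Longrightarrow> X = M"
      using maximal_subgroup_avoiding[OF PB, of a] by metis
    have "b \<in> M" using subset_set_mult_right[OF P B] M(2) generate.incl[of b "{b}"] by blast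
    moreover have "g \<in> M \<or> inv a \<otimes> g \<in> M" if g: "g \<in> carrier G" for g
    proof (rule disjCI)
      assume n: "inv a \<otimes> g \<notin> M"
      have gg: "g \<otimes> g \<in> M" using sq[OF g] sub M(2) by blast
      have W: "subgroup (generate G {g}) G" using g by (rule subgroup_generate_singleton)
      show "g \<in> M"
      proof (rule ccontr)
        assume gM: "g \<notin> M"
        have "g \<in> M <#> generate G {g}"
          using subset_set_mult_right[OF M(1) W] generate.incl[of g "{g}"] by blast
        then have "a \<in> M <#> generate G {g}"
          using gM max[OF mult_subgroups[OF M(1) W]] subset_set_mult_left[OF M(1) W] by blast
        \<comment> \<open>\<open>a \<otimes> g\<close> and \<open>inv a \<otimes> g\<close> differ
          by the square \<open>a \<otimes> a\<close>, which lies in \<open>M\<close>, so this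
          contradicts \<open>n\<close>.\<close>
        then have ag: "a \<otimes> g \<in> M" using adjoin_square_root[OF M(1) g gg] M(3) by blast
        have aa: "a \<otimes> a \<in> M" using sq[OF a(1)] sub M(2) by blast
        have "a \<otimes> g = (a \<otimes> a) \<otimes> (inv a \<otimes> g)" using a g by (metis inv_closed inv_solve_left m_assoc m_closed)
        then show False using n ag subgroup_mult_mem_cancel[OF M(1) aa, of "inv a \<otimes> g"] a g by simp
      qed
    qed
    ultimately show ?thesis using M sub by blast
  qed
  obtain M where M: "subgroup M G" "?P \<subseteq> M" "t \<in> M" "s \<notin> M"
    and Mc: "\<And>g. g \<in> carrier G \<Longrightarrow> g \<in> M \<or> inv s \<otimes> g \<in> M"
    using complement[OF s nsq(1) t nsq(3)] by blast
  obtain M' where M': "subgroup M' G" "?P \<subseteq> M'" "s \<in> M'" "t \<notin> M'"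
    and Mc': "\<And>g. g \<in> carrier G \<Longrightarrow> g \<in> M' \<or> inv t \<otimes> g \<in> M'"
    using complement[OF t nsq(2) s] nsq(3) m_comm[OF s t] by auto
  \<comment> \<open>\<open>M\<close> contains \<open>t\<close> but not \<open>s\<close>, and
    \<open>M'\<close> contains \<open>s\<close> but not \<open>t\<close>. So \<open>\<one>\<close>,
    \<open>s\<close>, \<open>t\<close> and \<open>s \<otimes> t\<close> represent the four cosets of
    \<open>N\<close>.\<close>
  define N where "N = M \<inter> M'"
  have N: "subgroup N G" using subgroups_Inter_pair[OF M(1) M'(1)] by (simp add: N_def)
  have Nc: "\<And>x. x \<in> N \<Longrightarrow> x \<in> carrier G" using N by (rule subgroup.mem_carrier)
  have sN: "s \<notin> N" and tN: "t \<notin> N" using M M' by (auto simp: N_def)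
  have stN: "s \<otimes> t \<notin> N"
    using subgroup_mult_mem_cancel'[OF M(1) M(3) s] M(4) by (auto simp: N_def)
  have PN: "?P \<subseteq> N" using M M' by (auto simp: N_def)
  have zN: "z \<in> N" using sq[OF s] PN by (auto simp: z_def)
  \<comment> \<open>All of \<open>N\<close> is included so that \<open>S\<close> generates
    \<open>G\<close>. These colours are harmless, because the map defined below commutes with
    translations by \<open>N\<close>.\<close>
  define S where "S = N \<union> {s, inv s, t, inv t}"
  have Sc: "S \<subseteq> carrier G" using Nc s t by (auto simp: S_def)
  have inv_S: "inv r \<in> S" if "r \<in> S" for r
    using that s t subgroup.m_inv_closed[OF N] by (auto simp: S_def)
  have S: "inverse_closed_subset G S"
  proof -
    have "S \<subseteq> (\<lambda>s. inv s) ` S"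
    proof
      fix r assume r: "r \<in> S"
      then have "r = inv (inv r)" using Sc by auto
      then show "r \<in> (\<lambda>s. inv s) ` S" using inv_S[OF r] by blast
    qed
    then show ?thesis using Sc inv_S by (auto simp: inverse_closed_subset_def)
  qed
  have gen: "generate G S = carrier G"
  proof
    show "generate G S \<subseteq> carrier G" using Sc by (rule generate_incl)
    have GS: "subgroup (generate G S) G" using Sc by (rule generate_is_subgroup)
    have sub: "N \<subseteq> generate G S" "s \<in> generate G S" "t \<in> generate G S"
      by (auto simp: S_def intro: generate.incl)
    show "carrier G \<subseteq> generate G S"
    proof
      fix g assume g: "g \<in> carrier G"
      have 1: "h \<in> generate G S" if h: "h \<in> M" for h
      proof -
        have hc: "h \<in> carrier G" using M(1) h by (rule subgroup.mem_carrier)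
        have "inv t \<otimes> h \<in> M" using h M by (auto intro: subgroup.m_closed subgroup.m_inv_closed)
        then have "h \<in> N \<or> inv t \<otimes> h \<in> N" using Mc'[OF hc] h by (auto simp: N_def)
        moreover have "h = t \<otimes> (inv t \<otimes> h)" using t hc by (simp add: m_assoc[symmetric])
        ultimately show ?thesis using sub subgroup.m_closed[OF GS] by (metis subsetD)
      qed
      have "g = s \<otimes> (inv s \<otimes> g)" using s g by (simp add: m_assoc[symmetric])
      then show "g \<in> generate G S" using Mc[OF g] 1 sub subgroup.m_closed[OF GS] by metis
    qed
  qed
  have conn: "connected (cayley_graph G S)"
    using connected_cayley_graph_iff[OF S] gen by simp
  \<comment> \<open>This is the coset of \<open>s \<otimes> t\<close>: the square of
    \<open>s \<otimes> t\<close> is in \<open>N\<close>, so \<open>s \<otimes> t\<close> and its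
    inverse have the same coset.\<close>
  define D where "D = {g \<in> carrier G. g \<otimes> s \<otimes> t \<in> N}"
  have D_iff: "g \<otimes> r \<in> D \<longleftrightarrow> g \<in> D" if g: "g \<in> carrier G" and r: "r \<in> N" for g r
  proof -
    have "g \<otimes> r \<otimes> s \<otimes> t = r \<otimes> (g \<otimes> s \<otimes> t)" using g Nc[OF r] s t by (simp add: m_ac)
    then show ?thesis
      unfolding D_def using subgroup_mult_mem_cancel[OF N r, of "g \<otimes> s \<otimes> t"] g Nc[OF r] s t by simp
  qed
  define \<phi> where "\<phi> g = (if g \<in> D then g \<otimes> z else g)" for g
  have \<phi>c: "\<phi> g \<in> carrier G" if "g \<in> carrier G" for g using that zc by (simp add: \<phi>_def)
  have invol: "\<phi> (\<phi> g) = g" if g: "g \<in> carrier G" for g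
  proof (cases "g \<in> D")
    case True
    then have "\<phi> (\<phi> g) = g \<otimes> z \<otimes> z" using D_iff[OF g zN] by (simp add: \<phi>_def)
    then show ?thesis using g zc zz by (simp add: m_assoc z_def)
  qed (simp add: \<phi>_def)
  have cp: "\<phi> (g \<otimes> r) \<in> {\<phi> g \<otimes> r, \<phi> g \<otimes> inv r}" if g: "g \<in> carrier G" and r: "r \<in> S" for g r
  proof (cases "r \<in> N")
    case True
    then show ?thesis using D_iff[OF g True] g Nc[OF True] zc by (auto simp: \<phi>_def m_ac)
  next
    case False
    \<comment> \<open>Outside \<open>N\<close> every colour satisfies
      \<open>r \<otimes> r = z\<close>, so multiplication by \<open>z\<close> exchanges
      \<open>r\<close> and \<open>inv r\<close>. Hence the step remains \<open>r\<close> or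
      \<open>inv r\<close> even when only one of \<open>g\<close>, \<open>g \<otimes> r\<close> is
      in \<open>D\<close>.\<close>
    have rc: "r \<in> carrier G" using r Sc by blast
    have "r \<otimes> r = z"
    proof -
      have iz: "inv z = z" using zz zc by (auto simp: z_def intro: inv_equality)
      have "r \<in> {s, inv s, t, inv t}" using r False by (simp add: S_def)
      then show ?thesis using s t st iz by (auto simp: z_def inv_mult[symmetric])
    qed
    then have "inv r \<otimes> z = inv r \<otimes> (r \<otimes> r)" by simp
    also have "\<dots> = r" using rc by (simp add: m_assoc[symmetric])
    finally have i: "inv r \<otimes> z = r" .
    have "r \<otimes> z = (inv r \<otimes> z) \<otimes> z" using i by simp
    also have "\<dots> = inv r" using rc zc zz by (simp add: m_assoc z_def)
    finally have j: "r \<otimes> z = inv r" .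
    have "g \<otimes> z \<otimes> inv r = g \<otimes> r" using g zc rc i m_comm[OF zc, of "inv r"] by (simp add: m_assoc)
    moreover have "g \<otimes> r \<otimes> z = g \<otimes> inv r" using g zc rc j by (simp add: m_assoc)
    moreover have "g \<otimes> r \<otimes> z = g \<otimes> z \<otimes> r" using g zc rc by (simp add: m_ac)
    ultimately show ?thesis by (auto simp: \<phi>_def)
  qed
  \<comment> \<open>This one direction of adjacency suffices, since \<open>\<phi>\<close> is its own
    inverse on \<open>carrier G\<close>.\<close>
  have adj: "inv (\<phi> u) \<otimes> \<phi> v \<in> S" if uv: "u \<in> carrier G" "v \<in> carrier G" "inv u \<otimes> v \<in> S" for u v
  proof -
    let ?r = "inv u \<otimes> v"
    have rc: "?r \<in> carrier G" using uv by simp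
    have "v = u \<otimes> ?r" using uv by (simp add: m_assoc[symmetric])
    then have "\<phi> v \<in> {\<phi> u \<otimes> ?r, \<phi> u \<otimes> inv ?r}" using cp[OF uv(1,3)] by simp
    then have "inv (\<phi> u) \<otimes> \<phi> v \<in> {?r, inv ?r}"
      using \<phi>c[OF uv(1)] rc by (auto simp: m_assoc[symmetric] simp del: inv_mult_group)
    then show ?thesis using uv(3) inv_S by auto
  qed
  have "graph_automorphism (cayley_graph G S) \<phi>"
    unfolding graph_automorphism_def
  proof
    have v: "verts (cayley_graph G S) = carrier G" by (simp add: cayley_graph_def)
    show "bij_betw \<phi> (verts (cayley_graph G S)) (verts (cayley_graph G S))"
      unfolding v by (rule bij_betw_byWitness[of _ \<phi>]) (use invol \<phi>c in auto)
    show "\<forall>u\<in>verts (cayley_graph G S). \<forall>v\<in>verts (cayley_graph G S).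
      u \<rightarrow>\<^bsub>cayley_graph G S\<^esub> v \<longleftrightarrow> \<phi> u \<rightarrow>\<^bsub>cayley_graph G S\<^esub> \<phi> v"
      unfolding v
      using adj \<phi>c invol by (metis cayley_graph_adj_iff[OF Sc])
  qed
  moreover have "colour_preserving G S \<phi>"
    using cp by (auto simp: colour_preserving_def)
  moreover have "\<not> affine_map G \<phi>"
  proof
    assume a: "affine_map G \<phi>"
    have "s \<notin> D" "t \<notin> D" "\<one> \<notin> D" "s \<otimes> t \<in> D"
    proof -
      have "s \<otimes> s \<in> N" "t \<otimes> t \<in> N" using sq s t PN by auto
      then have "s \<otimes> s \<otimes> t \<in> N \<longleftrightarrow> t \<in> N" "(t \<otimes> t) \<otimes> s \<in> N \<longleftrightarrow> s \<in> N"
        using subgroup_mult_mem_cancel[OF N] s t by auto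
      moreover have "t \<otimes> s \<otimes> t = (t \<otimes> t) \<otimes> s" using s t by (simp add: m_ac)
      moreover have "s \<otimes> t \<otimes> s \<otimes> t = (s \<otimes> t) \<otimes> (s \<otimes> t)" using s t by (simp add: m_ac)
      moreover have "(s \<otimes> t) \<otimes> (s \<otimes> t) \<in> N" using sq[of "s \<otimes> t"] s t PN by auto
      ultimately show "s \<notin> D" "t \<notin> D" "\<one> \<notin> D" "s \<otimes> t \<in> D"
        using s t sN tN stN by (auto simp: D_def)
    qed
    then have v: "\<phi> \<one> = \<one>" "\<phi> s = s" "\<phi> t = t" "\<phi> (s \<otimes> t) = s \<otimes> t \<otimes> z" by (auto simp: \<phi>_def)
    have "s \<otimes> t \<otimes> z = s \<otimes> t" using affine_map_mult[OF a s t v(1)] v by simp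
    then show False using z1 zc s t by (simp add: z_def)
  qed
  ultimately have "\<not> CCA G S" by (auto simp: CCA_def)
  then show ?thesis using that S conn by blast
qed

section \<open>Signs of a colour-permuting map\<close>

text \<open>Finite generation enters through \<open>finite_inv\<close>, which lets a counting
  argument show that \<open>\<pi>\<close> preserves involutions even when \<open>S\<close> is
  infinite.\<close>

locale colour_permuting_map = comm_group G for G (structure) +
  fixes S :: "'a set" and \<phi> \<pi> :: "'a \<Rightarrow> 'a"
  assumes inverse_closed: "inverse_closed_subset G S"
    and generates: "generate G S = carrier G"
    and bij: "bij_betw \<phi> (carrier G) (carrier G)"
    and bij_\<pi>: "bij_betw \<pi> S S"
    and permutes: "\<lbrakk>g \<in> carrier G; s \<in> S\<rbrakk> \<Longrightarrow> \<phi> (g \<otimes> s) \<in> {\<phi> g \<otimes> \<pi> s, \<phi> g \<otimes> inv (\<pi> s)}"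
    and finite_inv: "finite {x \<in> carrier G. x \<otimes> x = \<one>}"
begin

text \<open>The sign is recorded as the group element \<open>\<pi> s\<close> or \<open>inv (\<pi> s)\<close> instead of \<open>\<plusminus>1\<close>, so that it
  is also well defined when \<open>\<pi> s\<close> is an involution.\<close>

definition step :: "'a \<Rightarrow> 'a \<Rightarrow> 'a" where
  "step g s = inv (\<phi> g) \<otimes> \<phi> (g \<otimes> s)"

lemma S_carrier: "s \<in> S \<Longrightarrow> s \<in> carrier G"
  using inverse_closed by (auto simp: inverse_closed_subset_def)

lemma inv_S: "s \<in> S \<Longrightarrow> inv s \<in> S"
  using inverse_closed by (auto simp: inverse_closed_subset_def)

lemma \<pi>_S: "s \<in> S \<Longrightarrow> \<pi> s \<in> S"
  using bij_\<pi> by (auto simp: bij_betw_def)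

lemma \<pi>_carrier: "s \<in> S \<Longrightarrow> \<pi> s \<in> carrier G"
  using \<pi>_S S_carrier by blast

lemma \<phi>_carrier: "g \<in> carrier G \<Longrightarrow> \<phi> g \<in> carrier G"
  using bij by (auto simp: bij_betw_def)

lemma \<phi>_eq_iff: "\<lbrakk>g \<in> carrier G; h \<in> carrier G\<rbrakk> \<Longrightarrow> \<phi> g = \<phi> h \<longleftrightarrow> g = h"
  using bij by (auto simp: bij_betw_def inj_on_def)

lemma step_carrier: "\<lbrakk>g \<in> carrier G; s \<in> S\<rbrakk> \<Longrightarrow> step g s \<in> carrier G"
  using \<phi>_carrier S_carrier by (simp add: step_def)

lemma \<phi>_mult: "\<lbrakk>g \<in> carrier G; s \<in> S\<rbrakk> \<Longrightarrow> \<phi> (g \<otimes> s) = \<phi> g \<otimes> step g s"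
  using \<phi>_carrier S_carrier by (simp add: step_def m_assoc[symmetric])

lemma step_cases:
  assumes "g \<in> carrier G" "s \<in> S"
  shows "step g s = \<pi> s \<or> step g s = inv (\<pi> s)"
  using permutes[OF assms] assms \<phi>_carrier \<pi>_carrier
  by (auto simp: step_def m_assoc[symmetric])

lemma step_eq_or_inv:
  assumes "g \<in> carrier G" "h \<in> carrier G" "s \<in> S"
  shows "step g s = step h s \<or> step g s = inv (step h s)"
  using step_cases[OF assms(1,3)] step_cases[OF assms(2,3)] \<pi>_carrier[OF assms(3)] by auto

text \<open>No relation between \<open>\<pi> (inv s)\<close> and \<open>\<pi> s\<close> is assumed,
  so the edge from \<open>g \<otimes> inv s\<close> to \<open>g\<close> is read backwards.\<close>

lemma \<phi>_mult_inv:
  assumes g: "g \<in> carrier G" and s: "s \<in> S"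
  shows "\<phi> (g \<otimes> inv s) \<in> {\<phi> g \<otimes> \<pi> s, \<phi> g \<otimes> inv (\<pi> s)}"
proof -
  let ?h = "g \<otimes> inv s"
  have c: "?h \<in> carrier G" "s \<in> carrier G" using g S_carrier[OF s] by auto
  have "?h \<otimes> s = g" using g c by (simp add: m_assoc)
  then have "\<phi> g \<in> {\<phi> ?h \<otimes> \<pi> s, \<phi> ?h \<otimes> inv (\<pi> s)}" using permutes[OF c(1) s] by simp
  then show ?thesis
    using \<phi>_carrier[OF c(1)] \<pi>_carrier[OF s] by (auto simp: m_assoc)
qed

text \<open>By injectivity the two neighbours of \<open>g\<close> have distinct images, and both
  images lie in \<open>{\<phi> g \<otimes> \<pi> s, \<phi> g \<otimes> inv (\<pi> s)}\<close>. So
  they are these two elements in some order, and the two elements differ.\<close>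

lemma \<phi>_neighbours:
  assumes g: "g \<in> carrier G" and s: "s \<in> S" "s \<otimes> s \<noteq> \<one>"
  shows "\<phi> (g \<otimes> s) \<otimes> \<phi> (g \<otimes> inv s) = \<phi> g \<otimes> \<phi> g" "\<pi> s \<otimes> \<pi> s \<noteq> \<one>"
proof -
  have sc: "s \<in> carrier G" and pc: "\<pi> s \<in> carrier G" and gc: "\<phi> g \<in> carrier G"
    using S_carrier \<pi>_carrier \<phi>_carrier g s by auto
  have "s \<noteq> inv s" using s(2) sc by (metis r_inv)
  then have "g \<otimes> s \<noteq> g \<otimes> inv s" using g sc by simp
  then have ne: "\<phi> (g \<otimes> s) \<noteq> \<phi> (g \<otimes> inv s)" using \<phi>_eq_iff g sc by simp
  note m = permutes[OF g s(1)] \<phi>_mult_inv[OF g s(1)]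
  have "(\<phi> g \<otimes> \<pi> s) \<otimes> (\<phi> g \<otimes> inv (\<pi> s)) = \<phi> g \<otimes> \<phi> g"
    using gc pc by (simp add: m_ac)
  moreover have "(\<phi> g \<otimes> inv (\<pi> s)) \<otimes> (\<phi> g \<otimes> \<pi> s) = (\<phi> g \<otimes> \<pi> s) \<otimes> (\<phi> g \<otimes> inv (\<pi> s))"
    using gc pc by (intro m_comm) auto
  ultimately show "\<phi> (g \<otimes> s) \<otimes> \<phi> (g \<otimes> inv s) = \<phi> g \<otimes> \<phi> g" using m ne by auto
  show "\<pi> s \<otimes> \<pi> s \<noteq> \<one>"
  proof
    assume "\<pi> s \<otimes> \<pi> s = \<one>"
    then have "inv (\<pi> s) = \<pi> s" using pc by (simp add: inv_equality)
    then show False using m ne by auto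
  qed
qed

text \<open>By \<open>\<phi>_neighbours\<close> only elements with trivial square are sent to
  elements with trivial square. So \<open>?I\<close> is contained in its image under
  \<open>\<pi>\<close>, and finiteness turns this into equality.\<close>

lemma \<pi>_involution:
  assumes "s \<in> S" "s \<otimes> s = \<one>"
  shows "\<pi> s \<otimes> \<pi> s = \<one>"
proof -
  let ?I = "{x \<in> S. x \<otimes> x = \<one>}"
  have "finite ?I" using finite_inv S_carrier by (auto elim: finite_subset[rotated])
  moreover have "?I \<subseteq> \<pi> ` ?I"
  proof
    fix y assume y: "y \<in> ?I"
    then obtain x where x: "x \<in> S" "y = \<pi> x" using bij_\<pi> by (auto simp: bij_betw_def)
    then have "x \<otimes> x = \<one>" using \<phi>_neighbours(2)[OF one_closed x(1)] y by auto
    then show "y \<in> \<pi> ` ?I" using x by blast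
  qed
  ultimately have "?I = \<pi> ` ?I"
    by (intro card_seteq finite_imageI card_image_le)
  then show ?thesis using assms by blast
qed

text \<open>The images of \<open>g\<close> and \<open>g \<otimes> s \<otimes> s\<close> multiply to
  the square of the image of \<open>g \<otimes> s\<close> between them, which forces equal steps. If
  \<open>s\<close> has trivial square, so has \<open>\<pi> s\<close>, and only one step is
  possible.\<close>

lemma step_mult_self:
  assumes g: "g \<in> carrier G" and s: "s \<in> S"
  shows "step (g \<otimes> s) s = step g s"
proof (cases "s \<otimes> s = \<one>")
  case True
  then have "inv (\<pi> s) = \<pi> s" using \<pi>_involution[OF s] \<pi>_carrier[OF s] by (simp add: inv_equality)
  then show ?thesis
    using step_cases[OF g s] step_cases[OF _ s, of "g \<otimes> s"] g S_carrier[OF s] by simp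
next
  case False
  have c: "g \<otimes> s \<in> carrier G" "s \<in> carrier G" using g S_carrier[OF s] by auto
  have e: "g \<otimes> s \<otimes> inv s = g" using g c by (simp add: m_assoc)
  have "\<phi> (g \<otimes> s \<otimes> s) \<otimes> \<phi> g = \<phi> (g \<otimes> s) \<otimes> \<phi> (g \<otimes> s)"
    using \<phi>_neighbours(1)[OF c(1) s False] by (simp only: e)
  then have "(\<phi> g \<otimes> step g s \<otimes> \<phi> g) \<otimes> step (g \<otimes> s) s = (\<phi> g \<otimes> step g s \<otimes> \<phi> g) \<otimes> step g s"
    using \<phi>_mult[OF c(1) s] \<phi>_mult[OF g s] \<phi>_carrier[OF g] step_carrier[OF g s] step_carrier[OF c(1) s]
    by (simp add: m_ac)
  then show ?thesis
    using \<phi>_carrier[OF g] step_carrier[OF g s] step_carrier[OF c(1) s] by simp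
qed

lemma step_change:
  assumes g: "g \<in> carrier G" and s: "s \<in> S" and t: "t \<in> S"
    and ne: "step (g \<otimes> t) s \<noteq> step g s"
  shows "s \<otimes> s = t \<otimes> t" "s \<otimes> s \<noteq> \<one>" "(s \<otimes> s) \<otimes> (s \<otimes> s) = \<one>" "step (g \<otimes> s) t \<noteq> step g t"
proof -
  define a b b' where "a = step g s" and "b = step g t" and "b' = step (g \<otimes> s) t"
  have sc: "s \<in> carrier G" and tc: "t \<in> carrier G" using s t S_carrier by auto
  have gs: "g \<otimes> s \<in> carrier G" and gt: "g \<otimes> t \<in> carrier G" using g sc tc by auto
  have ac: "a \<in> carrier G" and bc: "b \<in> carrier G" and b'c: "b' \<in> carrier G" and pc: "\<phi> g \<in> carrier G"
    using step_carrier \<phi>_carrier g gs s t by (auto simp: a_def b_def b'_def)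
  have ia: "step (g \<otimes> t) s = inv a"
    using ne step_eq_or_inv[OF gt g s] by (simp add: a_def)
  have aa: "a \<otimes> a \<noteq> \<one>" using ne ia ac by (auto simp: a_def[symmetric] intro: inv_equality)
  \<comment> \<open>The two paths to \<open>g \<otimes> s \<otimes> t\<close>, through
    \<open>g \<otimes> s\<close> and through \<open>g \<otimes> t\<close>, give
    \<open>a \<otimes> b' = b \<otimes> inv a\<close>.\<close>
  have "\<phi> g \<otimes> a \<otimes> b' = \<phi> (g \<otimes> s \<otimes> t)"
    using \<phi>_mult[OF gs t] \<phi>_mult[OF g s] by (simp add: a_def b'_def)
  also have "g \<otimes> s \<otimes> t = g \<otimes> t \<otimes> s" using g sc tc by (simp add: m_ac)
  also have "\<phi> (g \<otimes> t \<otimes> s) = \<phi> g \<otimes> b \<otimes> inv a"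
    using \<phi>_mult[OF gt s] \<phi>_mult[OF g t] ia by (simp add: b_def)
  finally have "a \<otimes> b' = b \<otimes> inv a" using pc ac bc b'c by (simp add: m_assoc)
  then have "(a \<otimes> b') \<otimes> a = b" using ac bc by (simp add: m_assoc)
  then have ab: "(a \<otimes> a) \<otimes> b' = b" using ac b'c by (simp add: m_ac)
  have bb': "b' \<noteq> b"
  proof
    assume "b' = b"
    then show False using ab aa bc ac l_cancel_one[of b "a \<otimes> a"] by simp
  qed
  then show "step (g \<otimes> s) t \<noteq> step g t" by (simp add: b_def b'_def)
  have b': "b' = inv b" using bb' step_eq_or_inv[OF gs g t] by (simp add: b_def b'_def)
  with ab have "b \<otimes> b = ((a \<otimes> a) \<otimes> inv b) \<otimes> b" by simp
  also have "\<dots> = a \<otimes> a" using ac bc by (simp add: m_assoc)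
  finally have aabb: "a \<otimes> a = b \<otimes> b" ..
  \<comment> \<open>The sign for \<open>r\<close> is constant along \<open>r\<close>, so moving by
    \<open>r \<otimes> r\<close> multiplies the image by the square of a single step. Injectivity of
    \<open>\<phi>\<close> then transfers equations between squares of steps to \<open>s\<close> and
    \<open>t\<close>.\<close>
  have dbl: "\<phi> (h \<otimes> (r \<otimes> r)) = \<phi> h \<otimes> (step h r \<otimes> step h r)" if h: "h \<in> carrier G" and r: "r \<in> S" for h r
  proof -
    have c: "r \<in> carrier G" "h \<otimes> r \<in> carrier G" using h S_carrier[OF r] by auto
    have "\<phi> (h \<otimes> (r \<otimes> r)) = \<phi> (h \<otimes> r \<otimes> r)" using h c by (simp add: m_assoc)
    then show ?thesis
      using \<phi>_mult[OF c(2) r] \<phi>_mult[OF h r] step_mult_self[OF h r] \<phi>_carrier[OF h] step_carrier[OF h r]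
      by (simp add: m_assoc)
  qed
  have "\<phi> (g \<otimes> (s \<otimes> s)) = \<phi> (g \<otimes> (t \<otimes> t))"
    using dbl[OF g s] dbl[OF g t] aabb by (simp add: a_def b_def)
  then show st: "s \<otimes> s = t \<otimes> t" using g sc tc \<phi>_eq_iff by simp
  have "\<phi> (g \<otimes> (s \<otimes> s)) \<noteq> \<phi> g"
    using dbl[OF g s] aa ac pc by (simp add: a_def[symmetric])
  then show "s \<otimes> s \<noteq> \<one>" using g by auto
  \<comment> \<open>Now the common square \<open>s \<otimes> s = t \<otimes> t\<close> is added at
    \<open>g \<otimes> s\<close>, where the step for \<open>t\<close> is \<open>inv b\<close> and
    the step for \<open>s\<close> is still \<open>a\<close>. The outcome is that
    \<open>a \<otimes> a\<close> is its own inverse.\<close>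
  have "\<phi> g \<otimes> a \<otimes> (inv b \<otimes> inv b) = \<phi> (g \<otimes> s \<otimes> (t \<otimes> t))"
    using dbl[OF gs t] \<phi>_mult[OF g s] b' by (simp add: a_def b'_def)
  also have "\<dots> = \<phi> g \<otimes> a \<otimes> (a \<otimes> a)"
    using dbl[OF gs s] \<phi>_mult[OF g s] step_mult_self[OF g s] st by (simp add: a_def)
  finally have "inv b \<otimes> inv b = a \<otimes> a" using ac bc pc by simp
  moreover have "inv b \<otimes> inv b = inv (b \<otimes> b)" using bc by (simp add: inv_mult)
  ultimately have "inv (a \<otimes> a) = a \<otimes> a" using aabb by simp
  then have a4: "(a \<otimes> a) \<otimes> (a \<otimes> a) = \<one>" using ac by (metis m_closed r_inv)
  have gss: "g \<otimes> (s \<otimes> s) \<in> carrier G" using g sc by simp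
  have "step (g \<otimes> (s \<otimes> s)) s = a"
    using step_mult_self[OF gs s] step_mult_self[OF g s] g sc by (simp add: a_def m_assoc)
  then have "\<phi> (g \<otimes> (s \<otimes> s) \<otimes> (s \<otimes> s)) = \<phi> g \<otimes> (a \<otimes> a) \<otimes> (a \<otimes> a)"
    using dbl[OF gss s] dbl[OF g s] by (simp add: a_def)
  also have "\<dots> = \<phi> g" using pc ac a4 by (simp add: m_assoc)
  finally have "g \<otimes> (s \<otimes> s) \<otimes> (s \<otimes> s) = g" using \<phi>_eq_iff g sc by simp
  then have "g \<otimes> ((s \<otimes> s) \<otimes> (s \<otimes> s)) = g" using g sc by (simp add: m_assoc)
  then show "(s \<otimes> s) \<otimes> (s \<otimes> s) = \<one>" using g sc by simp
qed

text \<open>This is a subgroup, so it is all of \<open>G\<close> once it contains \<open>S\<close>;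
  constancy of the sign for \<open>s\<close> can thus be checked on generators.\<close>

definition periods :: "'a \<Rightarrow> 'a set" where
  "periods s = {x \<in> carrier G. \<forall>g\<in>carrier G. step (g \<otimes> x) s = step g s}"

lemma subgroup_periods: "subgroup (periods s) G"
proof
  show "x \<otimes> y \<in> periods s" if "x \<in> periods s" "y \<in> periods s" for x y
    using that by (auto simp: periods_def m_assoc[symmetric])
  show "inv x \<in> periods s" if "x \<in> periods s" for x
  proof -
    have x: "x \<in> carrier G" and p: "\<And>g. g \<in> carrier G \<Longrightarrow> step (g \<otimes> x) s = step g s"
      using that by (auto simp: periods_def)
    have "step (g \<otimes> inv x) s = step g s" if g: "g \<in> carrier G" for g
      using p[of "g \<otimes> inv x"] g x by (simp add: m_assoc)
    then show ?thesis using x by (auto simp: periods_def)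
  qed
qed (auto simp: periods_def)

lemma mem_periods_self: "s \<in> S \<Longrightarrow> s \<in> periods s"
  using step_mult_self S_carrier by (auto simp: periods_def)

text \<open>The last claim holds because \<open>step_change\<close> also reports a sign change with
  \<open>s\<close> and \<open>t\<close> exchanged.\<close>

lemma not_mem_periods:
  assumes "s \<in> S" "t \<in> S" "t \<notin> periods s"
  shows "s \<otimes> s = t \<otimes> t" "s \<otimes> s \<noteq> \<one>" "(s \<otimes> s) \<otimes> (s \<otimes> s) = \<one>" "s \<notin> periods t"
proof -
  obtain g where g: "g \<in> carrier G" "step (g \<otimes> t) s \<noteq> step g s"
    using assms S_carrier by (auto simp: periods_def)
  note c = step_change[OF g(1) assms(1,2) g(2)]
  show "s \<otimes> s = t \<otimes> t" "s \<otimes> s \<noteq> \<one>" "(s \<otimes> s) \<otimes> (s \<otimes> s) = \<one>" by (fact c)+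
  show "s \<notin> periods t" using c(4) g(1) by (auto simp: periods_def)
qed

text \<open>For \<open>x \<in> S\<close> either \<open>x\<close> is a period, or
  \<open>x \<otimes> x = s \<otimes> s\<close>, a period because \<open>s\<close> is one. The
  elements whose squares are periods form a subgroup, so the claim passes from \<open>S\<close> to
  \<open>G\<close>.\<close>

lemma squares_subset_periods:
  assumes s: "s \<in> S"
  shows "power_image G 2 \<subseteq> periods s"
proof -
  note P = subgroup_periods[of s]
  have "x \<otimes> x \<in> periods s" if "x \<in> S" for x
  proof (cases "x \<in> periods s")
    case True
    then show ?thesis using subgroup.m_closed[OF P] by blast
  next
    case False
    then show ?thesis
      using not_mem_periods(1)[OF s that] mem_periods_self[OF s] subgroup.m_closed[OF P] by metis
  qed
  then have "S \<subseteq> {x \<in> carrier G. x \<otimes> x \<in> periods s}" using S_carrier by blast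
  moreover have "subgroup {x \<in> carrier G. x \<otimes> x \<in> periods s} G"
  proof
    show "x \<otimes> y \<in> {x \<in> carrier G. x \<otimes> x \<in> periods s}"
      if "x \<in> {x \<in> carrier G. x \<otimes> x \<in> periods s}" "y \<in> {x \<in> carrier G. x \<otimes> x \<in> periods s}" for x y
    proof -
      have "(x \<otimes> y) \<otimes> (x \<otimes> y) = (x \<otimes> x) \<otimes> (y \<otimes> y)" using that by (simp add: m_ac)
      then show ?thesis using that subgroup.m_closed[OF P] by simp
    qed
    show "inv x \<in> {x \<in> carrier G. x \<otimes> x \<in> periods s}"
      if "x \<in> {x \<in> carrier G. x \<otimes> x \<in> periods s}" for x
    proof -
      have "inv x \<otimes> inv x = inv (x \<otimes> x)" using that by (simp add: inv_mult)
      then show ?thesis using that subgroup.m_inv_closed[OF P] by simp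
    qed
  qed (use subgroup.one_closed[OF P] in auto)
  ultimately have "carrier G \<subseteq> {x \<in> carrier G. x \<otimes> x \<in> periods s}"
    using generate_subgroup_incl generates by metis
  then show ?thesis by (auto simp: power_image_2)
qed

lemma affine_or_critical_pair: "affine_map G \<phi> \<or> (\<exists>s t. critical_pair G s t)"
proof (cases "\<forall>s\<in>S. S \<subseteq> periods s")
  case True
  have per: "periods s = carrier G" if "s \<in> S" for s
    using generate_subgroup_incl[OF bspec[OF True that] subgroup_periods] generates
      subgroup.subset[OF subgroup_periods] by auto
  have st: "step g s = step \<one> s" if "g \<in> carrier G" "s \<in> S" for g s
  proof -
    have "g \<in> periods s" using per that by simp
    then have "step (\<one> \<otimes> g) s = step \<one> s" unfolding periods_def by blast
    then show ?thesis using that by simp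
  qed
  \<comment> \<open>The homomorphism law for \<open>\<phi>\<close> divided by
    \<open>\<phi> \<one>\<close>, written without inverses so that the product case is a
    cancellation.\<close>
  have S1: "\<phi> (g \<otimes> h) \<otimes> \<phi> \<one> = \<phi> g \<otimes> \<phi> h" if "h \<in> generate G S" "g \<in> carrier G" for g h
    using that
  proof (induction h arbitrary: g rule: generate.induct)
    case one
    then show ?case using \<phi>_carrier by simp
  next
    case (incl h)
    have "\<phi> h = \<phi> \<one> \<otimes> step \<one> h" using \<phi>_mult[OF one_closed incl(1)] S_carrier[OF incl(1)] by simp
    then show ?case
      using \<phi>_mult[OF incl(2,1)] st[OF incl(2,1)] \<phi>_carrier[OF incl(2)] \<phi>_carrier[OF one_closed]
        step_carrier[OF one_closed incl(1)] by (simp add: m_ac)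
  next
    case (inv h)
    note i = inv_S[OF inv(1)]
    have "\<phi> (inv h) = \<phi> \<one> \<otimes> step \<one> (inv h)" using \<phi>_mult[OF one_closed i] S_carrier[OF i] by simp
    then show ?case
      using \<phi>_mult[OF inv(2) i] st[OF inv(2) i] \<phi>_carrier[OF inv(2)] \<phi>_carrier[OF one_closed]
        step_carrier[OF one_closed i] by (simp add: m_ac)
  next
    case (eng h1 h2)
    have c: "h1 \<in> carrier G" "h2 \<in> carrier G" using eng generates by auto
    note f = \<phi>_carrier[OF one_closed] \<phi>_carrier[OF c(1)] \<phi>_carrier[OF c(2)] \<phi>_carrier[OF eng.prems]
      \<phi>_carrier[OF m_closed[OF c]] \<phi>_carrier[OF m_closed[OF eng.prems m_closed[OF c]]]
      \<phi>_carrier[OF m_closed[OF eng.prems c(1)]]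
    have "\<phi> (g \<otimes> (h1 \<otimes> h2)) \<otimes> \<phi> \<one> = \<phi> (g \<otimes> h1) \<otimes> \<phi> h2"
      using eng.IH(2)[of "g \<otimes> h1"] eng.prems c by (simp add: m_assoc)
    then have "(\<phi> (g \<otimes> (h1 \<otimes> h2)) \<otimes> \<phi> \<one>) \<otimes> \<phi> \<one> = (\<phi> (g \<otimes> h1) \<otimes> \<phi> \<one>) \<otimes> \<phi> h2"
      using f by (simp add: m_ac)
    also have "\<dots> = \<phi> g \<otimes> (\<phi> h1 \<otimes> \<phi> h2)" using eng.IH(1)[OF eng.prems] f by (simp add: m_assoc)
    also have "\<phi> h1 \<otimes> \<phi> h2 = \<phi> (h1 \<otimes> h2) \<otimes> \<phi> \<one>" using eng.IH(2)[OF c(1)] by simp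
    finally have "(\<phi> (g \<otimes> (h1 \<otimes> h2)) \<otimes> \<phi> \<one>) \<otimes> \<phi> \<one> = (\<phi> g \<otimes> \<phi> (h1 \<otimes> h2)) \<otimes> \<phi> \<one>"
      using f by (simp add: m_assoc)
    then show ?case using f by (subst (asm) right_cancel) auto
  qed
  define b where "b = \<phi> \<one>"
  define \<tau> where "\<tau> x = \<phi> x \<otimes> inv b" for x
  have b: "b \<in> carrier G" using \<phi>_carrier by (simp add: b_def)
  have "\<tau> \<in> iso G G"
  proof (rule isoI)
    show "\<tau> \<in> hom G G"
    proof (rule homI)
      show "\<tau> x \<in> carrier G" if "x \<in> carrier G" for x using that b \<phi>_carrier by (simp add: \<tau>_def)
      fix x y assume xy: "x \<in> carrier G" "y \<in> carrier G"
      note f = \<phi>_carrier[OF xy(1)] \<phi>_carrier[OF xy(2)] \<phi>_carrier[OF m_closed[OF xy]]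
      have "\<phi> (x \<otimes> y) \<otimes> b = \<phi> x \<otimes> \<phi> y" using S1 xy generates by (simp add: b_def)
      then have "\<phi> (x \<otimes> y) = \<phi> x \<otimes> \<phi> y \<otimes> inv b" using f b by (metis inv_solve_right' m_closed)
      then show "\<tau> (x \<otimes> y) = \<tau> x \<otimes> \<tau> y" using f b by (simp add: \<tau>_def m_ac)
    qed
    have "bij_betw (\<lambda>y. y \<otimes> inv b) (carrier G) (carrier G)"
      by (rule bij_betw_byWitness[of _ "\<lambda>y. y \<otimes> b"]) (use b in \<open>auto simp: m_assoc\<close>)
    then show "bij_betw \<tau> (carrier G) (carrier G)"
      using bij_betw_trans[OF bij] unfolding \<tau>_def comp_def by blast
  qed
  moreover have "\<phi> x = \<tau> x \<otimes> b" if "x \<in> carrier G" for x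
    using that b \<phi>_carrier by (simp add: \<tau>_def m_assoc)
  ultimately show ?thesis using b unfolding affine_map_def by blast
next
  case False
  then obtain s t where s: "s \<in> S" and t: "t \<in> S" and n: "t \<notin> periods s" by blast
  note c = not_mem_periods[OF s t n]
  have "s \<notin> power_image G 2" using c(4) squares_subset_periods[OF t] by blast
  moreover have "t \<notin> power_image G 2" using n squares_subset_periods[OF s] by blast
  \<comment> \<open>As \<open>s\<close> is a period of its own sign, \<open>s \<otimes> t\<close> is
    a period exactly when \<open>t\<close> is.\<close>
  moreover have "s \<otimes> t \<notin> periods s"
    using n subgroup_mult_mem_cancel[OF subgroup_periods mem_periods_self[OF s] S_carrier[OF t]] by blast
  then have "s \<otimes> t \<notin> power_image G 2" using squares_subset_periods[OF s] by blast
  ultimately show ?thesis using c S_carrier s t unfolding critical_pair_def by blast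
qed

end

lemma (in comm_group) not_strongly_CCA_imp_critical_pair:
  assumes fg: "finitely_generated_group G" and S: "inverse_closed_subset G S"
    and conn: "connected (cayley_graph G S)" and n: "\<not> strongly_CCA G S"
  shows "\<exists>s t. critical_pair G s t"
proof -
  obtain \<phi> \<pi> where \<phi>: "graph_automorphism (cayley_graph G S) \<phi>" "\<not> affine_map G \<phi>"
    and \<pi>: "bij_betw \<pi> S S"
      "\<And>g s. \<lbrakk>g \<in> carrier G; s \<in> S\<rbrakk> \<Longrightarrow> \<phi> (g \<otimes> s) \<in> {\<phi> g \<otimes> \<pi> s, \<phi> g \<otimes> inv (\<pi> s)}"
    using n unfolding strongly_CCA_def colour_permuting_def by blast
  have "bij_betw \<phi> (carrier G) (carrier G)"
    using \<phi>(1) by (simp add: graph_automorphism_def cayley_graph_def)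
  then interpret colour_permuting_map G S \<phi> \<pi>
    using S conn \<pi> finite_involutions[OF fg] connected_cayley_graph_iff[OF S]
    by unfold_locales auto
  show ?thesis using affine_or_critical_pair \<phi>(2) by blast
qed

section \<open>Critical pairs and direct summands\<close>

text \<open>This is \<open>cyclic_complement\<close> for \<open>m = 0\<close>, where the generator
  itself is the element to be avoided.\<close>

lemma (in comm_group) involution_complement:
  assumes e: "e \<in> carrier G" "e \<otimes> e = \<one>"
    and Q: "subgroup Q G" "power_image G 2 \<subseteq> Q" "e \<notin> Q"
  obtains M where "internal_sum G (generate G {e}) M" "Q \<subseteq> M"
  using cyclic_complement[OF Q(1) e(1), of 0] e Q by (auto simp: numeral_2_eq_2)

lemma (in group) ord_involution:
  assumes "e \<in> carrier G" "e \<otimes> e = \<one>" "e \<noteq> \<one>"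
  shows "ord e = 2"
  using ord_eq_prime_power[OF two_is_prime_nat, of e 0] assms by (auto simp: numeral_2_eq_2)

lemma (in comm_group) internal_sum_iso_DirProd:
  assumes HM: "internal_sum G H M" and HM': "internal_sum G H' M'" and sub: "H \<subseteq> M'" "H' \<subseteq> M"
    and iso: "G\<lparr>carrier := H\<rparr> \<cong> X" "G\<lparr>carrier := H'\<rparr> \<cong> Y"
  shows "G\<lparr>carrier := H <#> H'\<rparr> \<cong> X \<times>\<times> Y"
proof -
  have H: "subgroup H G" and H': "subgroup H' G" using HM HM' by (auto simp: internal_sum_def)
  have "H \<inter> H' = {\<one>}"
    using HM sub subgroup.one_closed[OF H] subgroup.one_closed[OF H'] unfolding internal_sum_def by blast
  then show ?thesis
    using iso_trans[OF set_mult_iso_DirProd[OF H H']]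
      group.DirProd_iso_trans[OF subgroup_imp_group[OF H] iso] by blast
qed

lemma (in comm_group) critical_pair_imp_summand:
  assumes fg: "finitely_generated_group G" and "critical_pair G s t"
  shows "has_direct_summand_iso G (integer_mod_group 4 \<times>\<times> integer_mod_group 2)
    \<or> (\<exists>n::nat. n \<ge> 3 \<and> has_direct_summand_iso G
         (integer_mod_group (2 ^ n) \<times>\<times> integer_mod_group 2 \<times>\<times> integer_mod_group 2))"
proof -
  let ?P = "power_image G"
  have s: "s \<in> carrier G" and t: "t \<in> carrier G" and st: "s \<otimes> s = t \<otimes> t"
    and nsq: "s \<notin> ?P 2" "t \<notin> ?P 2" "s \<otimes> t \<notin> ?P 2"
    using assms(2) by (auto simp: critical_pair_def)
  define z u where "z = s \<otimes> s" and "u = s \<otimes> t"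
  have z: "z \<in> carrier G" "z \<otimes> z = \<one>" "z \<noteq> \<one>"
    using assms(2) by (auto simp: critical_pair_def z_def)
  have P2: "subgroup (?P 2) G" by (rule subgroup_power_image)
  have sq: "x \<otimes> x \<in> ?P 2" if "x \<in> carrier G" for x using that by (auto simp: power_image_2)
  have zP: "z \<in> ?P 2" using sq[OF s] by (simp add: z_def)
  have u: "u \<in> carrier G" using s t by (simp add: u_def)
  have "u \<otimes> u = (s \<otimes> s) \<otimes> (t \<otimes> t)" unfolding u_def using s t by (simp add: m_ac)
  then have uu: "u \<otimes> u = \<one>" using z(2) st by (simp add: z_def)
  have uP: "u \<notin> ?P 2" using nsq by (simp add: u_def)
  then have u1: "u \<noteq> \<one>" using subgroup.one_closed[OF P2] by blast
  have gen: "subgroup (generate G {x}) G" if "x \<in> carrier G" for x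
    using that by (rule subgroup_generate_singleton)
  have self: "x \<in> generate G {x}" for x by (rule generate.incl) simp
  \<comment> \<open>\<open>z\<close> lies in \<open>?P 1\<close> and \<open>?P 2\<close>, so
    \<open>a\<close> is at least 2. With \<open>a = Suc m\<close>, this \<open>m\<close> is the
    largest exponent such that \<open>z \<in> ?P (2 ^ m)\<close>.\<close>
  define a where "a = (LEAST a. z \<notin> ?P (2 ^ a))"
  obtain a' where "z \<notin> ?P (2 ^ a')" using involution_finite_height[OF fg z] by blast
  then have a: "z \<notin> ?P (2 ^ a)" unfolding a_def by (rule LeastI)
  have "a \<noteq> 0" using a z(1) by (intro notI) (auto simp: power_image_def)
  moreover have "a \<noteq> 1" using a zP by auto
  ultimately obtain m where m: "a = Suc m" "m \<ge> 1" by (cases a) auto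
  have "z \<in> ?P (2 ^ m)" using not_less_Least[of m "\<lambda>a. z \<notin> ?P (2 ^ a)"] m a_def by auto
  then obtain w where w: "w \<in> carrier G" "z = w [^] (2 ^ m :: nat)" by (auto simp: power_image_def)
  let ?Q = "?P (2 ^ Suc m)"
  have Q: "subgroup ?Q G" by (rule subgroup_power_image)
  have QP: "?Q \<subseteq> ?P 2" by (rule power_image_antimono) simp
  have zQ: "z \<notin> ?Q" using a m by simp
  show ?thesis
  proof (cases "m = 1")
    case True
    have Qu: "subgroup (?Q <#> generate G {u}) G" using mult_subgroups[OF Q gen[OF u]] .
    have Ps: "subgroup (?P 2 <#> generate G {s}) G" using mult_subgroups[OF P2 gen[OF s]] .
    \<comment> \<open>This allows a complement of the group of \<open>s\<close> that contains
      \<open>u\<close>; below, the group of \<open>u\<close> likewise gets a complement containing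
      \<open>s\<close>, as \<open>internal_sum_refine\<close> requires.\<close>
    have "z \<notin> ?Q <#> generate G {u}"
    proof
      assume "z \<in> ?Q <#> generate G {u}"
      then have "z \<otimes> u \<in> ?Q"
        using adjoin_square_root[OF Q u] uu subgroup.one_closed[OF Q] zQ by auto
      then show False using QP uP subgroup_mult_mem_cancel[OF P2 zP u] by blast
    qed
    moreover have s4: "s [^] (2 ^ Suc m :: nat) = \<one>" "s [^] (2 ^ m :: nat) = z"
      using True s z by (auto simp: numeral_2_eq_2 z_def m_assoc)
    ultimately obtain K where K: "internal_sum G (generate G {s}) K" "?Q <#> generate G {u} \<subseteq> K"
      using cyclic_complement[OF Qu s s4(1) subset_set_mult_left[OF Q gen[OF u]]] by auto
    have "u \<notin> ?P 2 <#> generate G {s}"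
    proof
      assume "u \<in> ?P 2 <#> generate G {s}"
      then have us: "u \<otimes> s \<in> ?P 2" using adjoin_square_root[OF P2 s sq[OF s]] uP by blast
      have "u \<otimes> s = z \<otimes> t" using s t by (simp add: u_def z_def m_ac)
      then show False using us nsq subgroup_mult_mem_cancel[OF P2 zP t] by simp
    qed
    then obtain M where M: "internal_sum G (generate G {u}) M" "?P 2 <#> generate G {s} \<subseteq> M"
      using involution_complement[OF u uu Ps subset_set_mult_left[OF P2 gen[OF s]]] by auto
    have sub: "generate G {s} \<subseteq> M" "generate G {u} \<subseteq> K"
      using subset_set_mult_right[OF P2 gen[OF s]] subset_set_mult_right[OF Q gen[OF u]] K M by auto
    have "ord s = 4" using ord_eq_prime_power[OF two_is_prime_nat s s4(1)] s4(2) z(3) True by simp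
    then have "G\<lparr>carrier := generate G {s}\<rparr> \<cong> integer_mod_group 4"
      using generate_singleton_iso[OF s] by simp
    moreover have "G\<lparr>carrier := generate G {u}\<rparr> \<cong> integer_mod_group 2"
      using generate_singleton_iso[OF u] ord_involution[OF u uu u1] by simp
    ultimately show ?thesis
      using internal_sum_refine[OF K(1) M(1) sub] internal_sum_iso_DirProd[OF K(1) M(1) sub]
      unfolding has_direct_summand_iso_def direct_summand_iff by blast
  next
    case False
    \<comment> \<open>Another square root of \<open>z\<close>, which for \<open>m \<ge> 2\<close> is
      itself a square. Dividing \<open>s\<close> by it gives an involution \<open>e\<close> in the
      class of \<open>s\<close> modulo squares, and \<open>e \<otimes> u\<close> is then in the
      class of \<open>t\<close>.\<close>
    define v where "v = w [^] (2 ^ (m - 1) :: nat)"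
    have v: "v \<in> carrier G" using w by (simp add: v_def)
    have "(2::nat) ^ m = 2 ^ (m - 1) + 2 ^ (m - 1)" using m(2) by (cases m) auto
    then have vv: "v \<otimes> v = z" using w by (simp add: v_def nat_pow_mult)
    have "2 dvd (2::nat) ^ (m - 1)" using m(2) False by simp
    then have "?P (2 ^ (m - 1)) \<subseteq> ?P 2" by (rule power_image_antimono)
    then have vP: "v \<in> ?P 2" using w(1) unfolding v_def power_image_def[of G "2 ^ (m - 1)"] by blast
    define e where "e = s \<otimes> inv v"
    have e: "e \<in> carrier G" using s v by (simp add: e_def)
    have "e \<otimes> e = (s \<otimes> s) \<otimes> inv (v \<otimes> v)" unfolding e_def using s v by (simp add: inv_mult m_ac)
    then have ee: "e \<otimes> e = \<one>" using z(1) vv by (simp add: z_def)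
    have ivP: "inv v \<in> ?P 2" using subgroup.m_inv_closed[OF P2 vP] .
    have eP: "e \<notin> ?P 2"
      unfolding e_def using nsq(1) subgroup_mult_mem_cancel'[OF P2 ivP s] by simp
    then have e1: "e \<noteq> \<one>" using subgroup.one_closed[OF P2] by blast
    have "e \<otimes> u = (z \<otimes> inv v) \<otimes> t" unfolding e_def u_def z_def using s t v by (simp add: m_ac)
    then have euP: "e \<otimes> u \<notin> ?P 2"
      using nsq(2) subgroup_mult_mem_cancel[OF P2 subgroup.m_closed[OF P2 zP ivP] t] by simp
    have ueP: "u \<otimes> e \<notin> ?P 2" using euP m_comm[OF u e] by simp
    \<comment> \<open>The power \<open>2 ^ m\<close> kills \<open>x\<close> and sends
      \<open>w\<close> to \<open>z\<close>. So if \<open>x \<otimes> w\<close> were a square,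
      \<open>z\<close> would lie in \<open>?Q\<close>, against the choice of
      \<open>m\<close>.\<close>
    have xw: "x \<otimes> w \<notin> ?P 2" if x: "x \<in> carrier G" "x \<otimes> x = \<one>" for x
    proof
      assume "x \<otimes> w \<in> ?P 2"
      then obtain y where y: "y \<in> carrier G" "x \<otimes> w = y [^] (2::nat)" by (auto simp: power_image_def)
      have "y [^] (2 ^ Suc m :: nat) = (x \<otimes> w) [^] (2 ^ m :: nat)"
        unfolding y(2) using y(1) by (simp add: nat_pow_pow)
      also have "\<dots> = x [^] (2 ^ m :: nat) \<otimes> z" using x w by (simp add: nat_pow_distrib)
      also have "x [^] (2 ^ m :: nat) = (x [^] (2::nat)) [^] (2 ^ (m - 1) :: nat)"
        using x(1) m(2) by (cases m) (auto simp: nat_pow_pow)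
      also have "x [^] (2::nat) = \<one>" using x by (simp add: numeral_2_eq_2)
      finally have "y [^] (2 ^ Suc m :: nat) = z" using z(1) by simp
      then show False using zQ y(1) by (auto simp: power_image_def)
    qed
    have adjoin_w: "x \<notin> ?P 2 <#> generate G {w}" if "x \<in> carrier G" "x \<otimes> x = \<one>" "x \<notin> ?P 2" for x
      using adjoin_square_root[OF P2 w(1) sq[OF w(1)]] xw that by blast
    let ?W = "?P 2 <#> generate G {w}"
    have W: "subgroup ?W G" using mult_subgroups[OF P2 gen[OF w(1)]] .
    have PW: "?P 2 \<subseteq> ?W" "generate G {w} \<subseteq> ?W"
      using subset_set_mult_left[OF P2 gen[OF w(1)]] subset_set_mult_right[OF P2 gen[OF w(1)]] by auto
    \<comment> \<open>Applied to \<open>e\<close>, \<open>u\<close> and to \<open>u\<close>,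
      \<open>e\<close>: each of these involutions gets a complement containing the other one and
      \<open>w\<close>.\<close>
    have split: "\<exists>M. internal_sum G (generate G {x}) M \<and> generate G {w} \<subseteq> M \<and> generate G {y} \<subseteq> M"
      if x: "x \<in> carrier G" "x \<otimes> x = \<one>" "x \<notin> ?P 2" and y: "y \<in> carrier G" "y \<otimes> y = \<one>"
        and xy: "x \<otimes> y \<notin> ?P 2" for x y
    proof -
      let ?R = "?W <#> generate G {y}"
      have R: "subgroup ?R G" using mult_subgroups[OF W gen[OF y(1)]] .
      have WR: "?W \<subseteq> ?R" "generate G {y} \<subseteq> ?R"
        using subset_set_mult_left[OF W gen[OF y(1)]] subset_set_mult_right[OF W gen[OF y(1)]] by auto
      have "(x \<otimes> y) \<otimes> (x \<otimes> y) = (x \<otimes> x) \<otimes> (y \<otimes> y)" using x(1) y(1) by (simp add: m_ac)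
      then have "(x \<otimes> y) \<otimes> (x \<otimes> y) = \<one>" using x(2) y(2) by simp
      then have "x \<notin> ?W" "x \<otimes> y \<notin> ?W" using adjoin_w x y(1) xy by auto
      then have "x \<notin> ?R"
        using adjoin_square_root[OF W y(1)] y(2) subgroup.one_closed[OF W] by auto
      moreover have "?P 2 \<subseteq> ?R" using PW WR by blast
      ultimately obtain M where "internal_sum G (generate G {x}) M" "?R \<subseteq> M"
        using involution_complement[OF x(1,2) R] by blast
      then show ?thesis using PW WR by blast
    qed
    obtain M where M: "internal_sum G (generate G {e}) M" "generate G {w} \<subseteq> M" "generate G {u} \<subseteq> M"
      using split[OF e ee eP u uu euP] by blast
    obtain M' where M': "internal_sum G (generate G {u}) M'" "generate G {w} \<subseteq> M'" "generate G {e} \<subseteq> M'"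
      using split[OF u uu uP e ee ueP] by blast
    let ?E = "?Q <#> generate G {e}"
    let ?R = "?E <#> generate G {u}"
    have E: "subgroup ?E G" using mult_subgroups[OF Q gen[OF e]] .
    have R: "subgroup ?R G" using mult_subgroups[OF E gen[OF u]] .
    have QE: "?Q \<subseteq> ?E" "generate G {e} \<subseteq> ?E"
      using subset_set_mult_left[OF Q gen[OF e]] subset_set_mult_right[OF Q gen[OF e]] by auto
    have ER: "?E \<subseteq> ?R" "generate G {u} \<subseteq> ?R"
      using subset_set_mult_left[OF E gen[OF u]] subset_set_mult_right[OF E gen[OF u]] by auto
    \<comment> \<open>Otherwise \<open>z\<close> times one of \<open>e\<close>, \<open>u\<close>,
      \<open>u \<otimes> e\<close> would lie in \<open>?Q\<close>, and that element would be a
      square.\<close>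
    have "z \<notin> ?R"
    proof
      assume "z \<in> ?R"
      then have "z \<in> ?E \<or> z \<otimes> u \<in> ?E"
        using adjoin_square_root[OF E u] uu subgroup.one_closed[OF E] by auto
      then have "z \<otimes> e \<in> ?Q \<or> z \<otimes> u \<in> ?Q \<or> (z \<otimes> u) \<otimes> e \<in> ?Q"
        using adjoin_square_root[OF Q e] ee subgroup.one_closed[OF Q] zQ by auto
      then have "z \<otimes> e \<in> ?P 2 \<or> z \<otimes> u \<in> ?P 2 \<or> z \<otimes> (u \<otimes> e) \<in> ?P 2"
        using QP m_assoc[OF z(1) u e] by auto
      then show False
        using subgroup_mult_mem_cancel[OF P2 zP] e u eP uP ueP by auto
    qed
    then have zR: "w [^] (2 ^ m :: nat) \<notin> ?R" using w(2) by simp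
    have "w [^] (2 ^ Suc m :: nat) = z \<otimes> z"
      using w by (simp add: nat_pow_mult mult_2)
    then have w1: "w [^] (2 ^ Suc m :: nat) = \<one>" using z(2) by simp
    obtain K where K: "internal_sum G (generate G {w}) K" "?R \<subseteq> K"
      using cyclic_complement[OF R w(1) w1 subset_trans[OF QE(1) ER(1)] zR] by blast
    \<comment> \<open>Products of groups are bracketed to the right, so the two factors of order 2
      are joined before the group of \<open>w\<close> is added.\<close>
    have eu: "internal_sum G (generate G {e} <#> generate G {u}) (M \<inter> M')"
      using internal_sum_refine[OF M(1) M'(1)] M M' by blast
    have Kg: "subgroup K G" using K(1) by (simp add: internal_sum_def)
    have sub: "generate G {w} \<subseteq> M \<inter> M'" "generate G {e} <#> generate G {u} \<subseteq> K"
    proof -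
      show "generate G {w} \<subseteq> M \<inter> M'" using M M' by blast
      have "generate G {e} \<subseteq> K" "generate G {u} \<subseteq> K" using QE ER K(2) by auto
      then show "generate G {e} <#> generate G {u} \<subseteq> K"
        using subgroup.m_closed[OF Kg] unfolding subset_iff mem_set_mult by metis
    qed
    have "ord w = 2 ^ Suc m"
      using ord_eq_prime_power[OF two_is_prime_nat w(1), of m] w z by (simp add: nat_pow_mult mult_2)
    then have "G\<lparr>carrier := generate G {w}\<rparr> \<cong> integer_mod_group (2 ^ Suc m)"
      using generate_singleton_iso[OF w(1)] by simp
    moreover have "G\<lparr>carrier := generate G {u}\<rparr> \<cong> integer_mod_group 2"
      using generate_singleton_iso[OF u] ord_involution[OF u uu u1] by simp
    moreover have "G\<lparr>carrier := generate G {e}\<rparr> \<cong> integer_mod_group 2"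
      using generate_singleton_iso[OF e] ord_involution[OF e ee e1] by simp
    ultimately have "has_direct_summand_iso G
        (integer_mod_group (2 ^ Suc m) \<times>\<times> integer_mod_group 2 \<times>\<times> integer_mod_group 2)"
      using internal_sum_refine[OF K(1) eu sub] internal_sum_iso_DirProd[OF K(1) eu sub]
        internal_sum_iso_DirProd[OF M(1) M'(1) M'(3) M(3)]
      unfolding has_direct_summand_iso_def direct_summand_iff by blast
    moreover have "Suc m \<ge> 3" using m(2) False by simp
    ultimately show ?thesis by blast
  qed
qed

section \<open>Critical pairs from direct summands\<close>

text \<open>If a square of \<open>G\<close> lies in the summand \<open>H\<close>, the square of the
  \<open>K\<close>-component of its root is trivial, so it is already a square in \<open>H\<close>.
  Hence nonsquares of \<open>X\<close> correspond to nonsquares of \<open>G\<close>.\<close>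

lemma (in comm_group) critical_pair_lift:
  assumes summand: "has_direct_summand_iso G X" and X: "group X" and ab: "critical_pair X a b"
  shows "\<exists>s t. critical_pair G s t"
proof -
  interpret X: group X by (rule X)
  obtain H K h where HK: "internal_sum G H K" and h: "h \<in> iso (G\<lparr>carrier := H\<rparr>) X"
    using summand by (auto simp: has_direct_summand_iso_def direct_summand_iff is_iso_def)
  have H: "subgroup H G" and K: "subgroup K G" and int: "H \<inter> K = {\<one>}" and HKG: "H <#> K = carrier G"
    using HK by (auto simp: internal_sum_def)
  note c = subgroup.mem_carrier[OF H] subgroup.mem_carrier[OF K]
  have bij: "bij_betw h H (carrier X)" using h by (simp add: iso_def)
  have mult: "h (x \<otimes> y) = h x \<otimes>\<^bsub>X\<^esub> h y" if "x \<in> H" "y \<in> H" for x y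
    using h that by (simp add: iso_def hom_def)
  have hc: "h x \<in> carrier X" if "x \<in> H" for x using bij that by (auto simp: bij_betw_def)
  have inj: "h x = h y \<longleftrightarrow> x = y" if "x \<in> H" "y \<in> H" for x y
    using bij that by (auto simp: bij_betw_def inj_on_def)
  have h1: "h \<one> = \<one>\<^bsub>X\<^esub>"
    using mult[of \<one> \<one>] hc[of \<one>] subgroup.one_closed[OF H] by (simp add: X.l_cancel_one')
  have ac: "a \<in> carrier X" "b \<in> carrier X" using ab by (auto simp: critical_pair_def)
  obtain s t where s: "s \<in> H" "h s = a" and t: "t \<in> H" "h t = b"
    using ac bij by (metis bij_betw_imp_surj_on imageE)
  have sq: "h x \<in> power_image X 2" if x: "x \<in> H" "x \<in> power_image G 2" for x
  proof -
    obtain y where y: "y \<in> carrier G" "x = y \<otimes> y" using x(2) by (auto simp: power_image_2)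
    have "y \<in> H <#> K" using y(1) HKG by simp
    then obtain p q where pq: "p \<in> H" "q \<in> K" "y = p \<otimes> q" by (auto simp: mem_set_mult)
    have e: "x = (p \<otimes> p) \<otimes> (q \<otimes> q)" unfolding y(2) pq(3) using pq c by (simp add: m_ac)
    have pp: "p \<otimes> p \<in> H" "q \<otimes> q \<in> K" using pq H K by (auto intro: subgroup.m_closed)
    then have "q \<otimes> q \<in> H"
      using x(1) subgroup_mult_mem_cancel[OF H pp(1), of "q \<otimes> q"] c e by auto
    then have "q \<otimes> q = \<one>" using pp int by blast
    then have "x = p \<otimes> p" using e pq c by simp
    then show ?thesis using mult[OF pq(1) pq(1)] hc[OF pq(1)] X.power_image_2 by auto
  qed
  have cl: "s \<otimes> s \<in> H" "t \<otimes> t \<in> H" "s \<otimes> t \<in> H" "(s \<otimes> s) \<otimes> (s \<otimes> s) \<in> H" "\<one> \<in> H"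
    using s t H by (auto intro: subgroup.m_closed subgroup.one_closed)
  have im: "h (s \<otimes> s) = a \<otimes>\<^bsub>X\<^esub> a" "h (t \<otimes> t) = b \<otimes>\<^bsub>X\<^esub> b" "h (s \<otimes> t) = a \<otimes>\<^bsub>X\<^esub> b"
    "h ((s \<otimes> s) \<otimes> (s \<otimes> s)) = (a \<otimes>\<^bsub>X\<^esub> a) \<otimes>\<^bsub>X\<^esub> (a \<otimes>\<^bsub>X\<^esub> a)"
    using mult s t cl by auto
  have "s \<otimes> s = t \<otimes> t" "s \<otimes> s \<noteq> \<one>" "(s \<otimes> s) \<otimes> (s \<otimes> s) = \<one>"
    using ab inj cl im h1 unfolding critical_pair_def by metis+
  moreover have "s \<notin> power_image G 2" "t \<notin> power_image G 2" "s \<otimes> t \<notin> power_image G 2"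
    using ab sq s t cl(3) im(3) unfolding critical_pair_def by metis+
  ultimately show ?thesis using s t c unfolding critical_pair_def by blast
qed

text \<open>The sum is \<open>(2, 1)\<close>, and doubles have an even first and a zero second
  coordinate.\<close>

lemma critical_pair_Z4_Z2:
  "critical_pair (integer_mod_group 4 \<times>\<times> integer_mod_group 2) (1, 0) (1, 1)"
proof -
  have X: "group (integer_mod_group 4 \<times>\<times> integer_mod_group 2)" by (intro DirProd_group) auto
  have P: "power_image (integer_mod_group 4 \<times>\<times> integer_mod_group 2) 2 =
      (\<lambda>(x, y). ((x + x) mod 4, (y + y) mod 2)) ` ({0..<4} \<times> {0..<2})"
    unfolding monoid.power_image_2[OF group.is_monoid[OF X]]
    by (intro image_cong) (auto simp: carrier_integer_mod_group)
  have "2 * x mod 4 \<noteq> (1::int)" for x :: int by presburger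
  then show ?thesis
    unfolding critical_pair_def P by (auto simp: carrier_integer_mod_group)
qed

text \<open>The first coordinate has order 4 but is even, so the coordinates of order 2 are what
  keeps both elements and their sum \<open>(2 ^ (n - 1), 1, 1)\<close> from being doubles.\<close>

lemma critical_pair_Z2_power_Z2_Z2:
  assumes "n \<ge> 3"
  shows "critical_pair (integer_mod_group (2 ^ n) \<times>\<times> integer_mod_group 2 \<times>\<times> integer_mod_group 2)
    (2 ^ (n - 2), 1, 0) (2 ^ (n - 2), 0, 1)"
proof -
  let ?X = "integer_mod_group (2 ^ n) \<times>\<times> integer_mod_group 2 \<times>\<times> integer_mod_group 2"
  \<comment> \<open>With \<open>p\<close> the modulus is \<open>8 * p\<close> and the first
    coordinate \<open>2 * p\<close>, so the arithmetic is free of exponents.\<close>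
  define p :: int where "p = 2 ^ (n - 3)"
  have p: "p > 0" "(2::int) ^ n = 8 * p" "(2::int) ^ (n - 2) = 2 * p"
  proof -
    obtain k where "n = k + 3" using assms by (metis add.commute le_Suc_ex)
    then show "p > 0" "(2::int) ^ n = 8 * p" "(2::int) ^ (n - 2) = 2 * p"
      by (auto simp: p_def power_add)
  qed
  have X: "group ?X" by (intro DirProd_group) auto
  have P: "power_image ?X 2 =
      (\<lambda>(x, y, y'). ((x + x) mod (8 * p), (y + y) mod 2, (y' + y') mod 2)) ` ({0..<8 * p} \<times> {0..<2} \<times> {0..<2})"
    unfolding monoid.power_image_2[OF group.is_monoid[OF X]]
    by (intro image_cong) (auto simp: carrier_integer_mod_group p)
  have odd: "(y + y) mod 2 \<noteq> (1::int)" for y :: int by presburger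
  have "(2 * p + 2 * p) mod (8 * p) = 4 * p" using p(1) by simp
  moreover have "(4 * p + 4 * p) mod (8 * p) = 0" by simp
  ultimately show ?thesis
    using odd p unfolding critical_pair_def P by (auto simp: carrier_integer_mod_group)
qed

theorem corollary1p10:
  fixes G :: "('a, 'm) monoid_scheme"
  assumes "comm_group G" and "finitely_generated_group G"
  shows "((\<exists>S. inverse_closed_subset G S \<and> connected (cayley_graph G S) \<and> \<not> CCA G S)
            \<longleftrightarrow> (\<exists>S. inverse_closed_subset G S \<and> connected (cayley_graph G S)
                       \<and> \<not> strongly_CCA G S))
       \<and> ((\<exists>S. inverse_closed_subset G S \<and> connected (cayley_graph G S)
                       \<and> \<not> strongly_CCA G S)
            \<longleftrightarrow> has_direct_summand_iso G (integer_mod_group 4 \<times>\<times> integer_mod_group 2)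
                \<or> (\<exists>n::nat. n \<ge> 3 \<and>
                     has_direct_summand_iso G
                       (integer_mod_group (2 ^ n) \<times>\<times> integer_mod_group 2 \<times>\<times> integer_mod_group 2)))"
    (is "(?i \<longleftrightarrow> ?ii) \<and> (?ii \<longleftrightarrow> ?iii)")
proof -
  interpret comm_group G by fact
  have "colour_permuting G S \<phi>" if "colour_preserving G S \<phi>" for S \<phi>
    using that unfolding colour_preserving_def colour_permuting_def
    by (intro exI[of _ "\<lambda>s. s"]) (auto simp: bij_betw_def)
  then have "?i \<Longrightarrow> ?ii" unfolding CCA_def strongly_CCA_def by blast
  moreover have "?ii \<Longrightarrow> ?iii"
    using not_strongly_CCA_imp_critical_pair critical_pair_imp_summand assms(2) by blast
  moreover have "\<exists>s t. critical_pair G s t" if ?iii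
    using that
  proof
    assume "has_direct_summand_iso G (integer_mod_group 4 \<times>\<times> integer_mod_group 2)"
    then show ?thesis
      by (rule critical_pair_lift[OF _ _ critical_pair_Z4_Z2]) (intro DirProd_group group_integer_mod_group)
  next
    assume "\<exists>n::nat. n \<ge> 3 \<and> has_direct_summand_iso G
      (integer_mod_group (2 ^ n) \<times>\<times> integer_mod_group 2 \<times>\<times> integer_mod_group 2)"
    then obtain n :: nat where n: "n \<ge> 3" "has_direct_summand_iso G
      (integer_mod_group (2 ^ n) \<times>\<times> integer_mod_group 2 \<times>\<times> integer_mod_group 2)" by blast
    show ?thesis
      by (rule critical_pair_lift[OF n(2) _ critical_pair_Z2_power_Z2_Z2[OF n(1)]])
        (intro DirProd_group group_integer_mod_group)
  qed
  then have "?iii \<Longrightarrow> ?i" using critical_pair_imp_not_CCA by metis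
  ultimately show ?thesis by blast
qed

end
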